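(* Let $d$ be a fixed constant. Learning an almost-tree of maximum degree $d$, height $h$ and $n$ vertices with path queries requires $\Omega(n\log n+nh)$ path queries: every deterministic algorithm that correctly determines the edge set of every such almost-tree (given only its vertex set and path-query access) uses $\Omega(n\log n+nh)$ queries on some such almost-tree, and every randomized algorithm that always correctly determines the edge set of every such almost-tree has expected number of queries $\Omega(n\log n+nh)$ on some such almost-tree.
   Context: An arborescence with root $r$ is a rooted directed acyclic graph with exactly one directed path from $r$ to each vertex. An almost-tree is a rooted DAG that is the union of an arborescence $T$ and one additional cross edge $(s,t)$, i.e. an edge such that neither of $s,t$ is an ancestor of the other in $T$; the almost-trees considered have no transitive edges (an edge $(u,v)$ is transitive if there is also a directed path from $u$ to $v$ of length greater than $1$). The height of an almost-tree is the length of its longest directed path. The degree of a vertex is its in-degree plus its out-degree. A path query $\mathsf{path}(u,v)$ returns $1$ if there is a directed path from $u$ to $v$ and $0$ otherwise.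
   Formalization: Adds d ≥ 3 and h ≤ (1−ε)n for a fixed ε > 0 (the constant depends on d, ε): for d = 2, or h = n−2 with d = 3, almost-trees are posets of width 2, learnable with O(n log n) queries though nh is quadratic; the bound likewise fails whenever n−h = o(n). *)

theory Defs
  imports "Graph_Theory.Graph_Theory" "HOL-Probability.Probability"
begin

definition rooted_dag :: "'a pair_pre_digraph \<Rightarrow> 'a \<Rightarrow> bool" where
  "rooted_dag G r \<longleftrightarrow>
     pair_fin_digraph G \<and> (\<nexists>c. pre_digraph.cycle (with_proj G) c) \<and>
     r \<in> pverts G \<and> (\<forall>v\<in>pverts G. r \<rightarrow>\<^sup>*\<^bsub>with_proj G\<^esub> v)"

definition arborescence :: "'a pair_pre_digraph \<Rightarrow> 'a \<Rightarrow> bool" where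
  "arborescence T r \<longleftrightarrow>
     rooted_dag T r \<and> (\<forall>v\<in>pverts T. \<exists>!p. pre_digraph.apath (with_proj T) r p v)"

definition cross_edge :: "'a pair_pre_digraph \<Rightarrow> 'a \<Rightarrow> 'a \<Rightarrow> bool" where
  "cross_edge T s t \<longleftrightarrow>
     s \<in> pverts T \<and> t \<in> pverts T \<and>
     \<not> s \<rightarrow>\<^sup>*\<^bsub>with_proj T\<^esub> t \<and> \<not> t \<rightarrow>\<^sup>*\<^bsub>with_proj T\<^esub> s"

definition transitive_edge :: "'a pair_pre_digraph \<Rightarrow> 'a \<Rightarrow> 'a \<Rightarrow> bool" where
  "transitive_edge G u v \<longleftrightarrow>
     (u, v) \<in> parcs G \<and> (\<exists>p. pre_digraph.apath (with_proj G) u p v \<and> length p > 1)"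

definition almost_tree :: "'a pair_pre_digraph \<Rightarrow> bool" where
  "almost_tree G \<longleftrightarrow>
     (\<exists>r. rooted_dag G r \<and>
        (\<exists>T s t. arborescence T r \<and> cross_edge T s t \<and>
           pverts G = pverts T \<and> parcs G = insert (s, t) (parcs T))) \<and>
     (\<forall>u v. \<not> transitive_edge G u v)"

text \<open>Walks are lists of arcs, so \<^term>\<open>length p\<close> is the number of edges of a path.\<close>

definition height :: "'a pair_pre_digraph \<Rightarrow> nat" where
  "height G = Max {length p | u p v. pre_digraph.apath (with_proj G) u p v}"

definition max_degree :: "'a pair_pre_digraph \<Rightarrow> nat" where
  "max_degree G =
     Max ((\<lambda>v. in_degree (with_proj G) v + out_degree (with_proj G) v) ` pverts G)"

text \<open>
  The lower bound needs \<open>d \<ge> 3\<close> and \<open>h\<close> bounded away from \<open>n\<close> by a constant factor: almost-trees with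
  \<open>d = 2\<close> (two directed paths with common ends) or with \<open>h = n - 2\<close> (a directed path and one further
  vertex) are posets of width 2, which \<open>O(n log n)\<close> queries determine although \<open>n h\<close> is quadratic.
\<close>

definition almost_trees :: "nat \<Rightarrow> nat \<Rightarrow> nat \<Rightarrow> nat pair_pre_digraph set" where
  "almost_trees n d h =
     {G. pverts G = {..<n} \<and> almost_tree G \<and> max_degree G = d \<and> height G = h}"

text \<open>
  A deterministic query algorithm on a known vertex set is a decision tree: it either stops and
  outputs an edge set, or asks one path query and continues with the first subtree if the answer
  is 1 and with the second one if it is 0. The tree may depend on \<open>n\<close>, \<open>d\<close> and \<open>h\<close>.
\<close>

datatype 'a query_alg =
    Output "('a \<times> 'a) set"
  | Query 'a 'a "'a query_alg" "'a query_alg"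

definition path_query :: "'a pair_pre_digraph \<Rightarrow> 'a \<Rightarrow> 'a \<Rightarrow> bool" where
  "path_query G u v \<longleftrightarrow> u \<rightarrow>\<^sup>*\<^bsub>with_proj G\<^esub> v"

primrec result :: "('a \<Rightarrow> 'a \<Rightarrow> bool) \<Rightarrow> 'a query_alg \<Rightarrow> ('a \<times> 'a) set" where
  "result ask (Output E) = E"
| "result ask (Query u v A B) = (if ask u v then result ask A else result ask B)"

primrec queries :: "('a \<Rightarrow> 'a \<Rightarrow> bool) \<Rightarrow> 'a query_alg \<Rightarrow> nat" where
  "queries ask (Output E) = 0"
| "queries ask (Query u v A B) = Suc (if ask u v then queries ask A else queries ask B)"

definition learns :: "'a query_alg \<Rightarrow> 'a pair_pre_digraph set \<Rightarrow> bool" where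
  "learns A \<G> \<longleftrightarrow> (\<forall>G\<in>\<G>. result (path_query G) A = parcs G)"

text \<open>
  A randomized algorithm is a probability distribution over deterministic ones. The expectation is
  a nonnegative integral, so that an infinite expected number of queries is \<open>\<infinity>\<close> rather than 0.
\<close>

definition always_learns :: "'a query_alg pmf \<Rightarrow> 'a pair_pre_digraph set \<Rightarrow> bool" where
  "always_learns P \<G> \<longleftrightarrow> (\<forall>A\<in>set_pmf P. learns A \<G>)"

definition expected_queries :: "'a query_alg pmf \<Rightarrow> 'a pair_pre_digraph \<Rightarrow> ennreal" where
  "expected_queries P G =
     (\<integral>\<^sup>+ A. ennreal (real (queries (path_query G) A)) \<partial>measure_pmf P)"

end

theory Submission
  imports Defs "HOL-Library.Discrete_Functions"
begin

text \<open>By Yao's principle it suffices to find a finite family of almost-trees on which every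
  deterministic algorithm is slow on average. If \<open>h = O(log n)\<close>, all relabellings of one almost-tree
  form such a family: bounded degree leaves at least \<open>n! / (n d\<^sup>n\<^sup>d)\<close> different graphs, while
  \<open>k\<close> queries distinguish at most \<open>2\<^sup>k\<close>. If \<open>h\<close> is larger, fix a tree in which \<open>\<Omega>(h)\<close> leaves \<open>s\<close>
  hang off a path that ends in a subtree with \<open>\<Omega>(n)\<close> leaves \<open>t\<close>, and add one of the \<open>\<Omega>(n h)\<close> cross
  edges \<open>(s, t)\<close>: no query other than \<open>path(s, t)\<close> reveals it. For bounded \<open>n\<close> a single query is
  enough, as the class is closed under relabelling and never a singleton.\<close>

subsection \<open>Query algorithms\<close>

text \<open>Two families are needed because counting outcomes stops at \<open>n log n\<close>: there
  are only 2 to the power O(n log n) almost-trees on \<open>n\<close> vertices. The term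
  \<open>n h\<close> has to come from an adversary argument, in which the missing information is
  small, one pair out of \<Omega>(n h), but each query can rule out only one candidate. The second
  family must hit \<open>h\<close> and \<open>d\<close> exactly and still offer \<Omega>(n)
  candidates for \<open>t\<close>. A balanced subtree holds them at logarithmic depth, so it does
  not outgrow the path once \<open>h\<close> is at least a suitable multiple of
  \<open>log n\<close>. For smaller \<open>h\<close> the term \<open>n h\<close> is absorbed by
  \<open>n log n\<close>, and nothing has to be constructed: any member of the class can be
  relabelled. The bound \<open>h \<le> (1 - \<epsilon>) n\<close> keeps linearly many vertices off
  the path.\<close>

lemma finite_card_results_within:
  "finite {result ask A | ask. queries ask A \<le> k} \<and> card {result ask A | ask. queries ask A \<le> k} \<le> 2 ^ k"
proof (induction A arbitrary: k)
  case (Output E)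
  have "{result ask (Output E) | ask. queries ask (Output E) \<le> k} = {E}"
    by auto
  then show ?case by simp
next
  case (Query u v A B)
  show ?case
  proof (cases k)
    case 0
    then have "{result ask (Query u v A B) | ask. queries ask (Query u v A B) \<le> k} = {}"
      by auto
    then show ?thesis by simp
  next
    case (Suc j)
    let ?R = "\<lambda>X. {result ask X | ask. queries ask X \<le> j}"
    have sub: "{result ask (Query u v A B) | ask. queries ask (Query u v A B) \<le> k} \<subseteq> ?R A \<union> ?R B"
      using Suc by (auto split: if_splits)
    have fin: "finite (?R A \<union> ?R B)"
      using Query.IH by blast
    have "card (?R A \<union> ?R B) \<le> card (?R A) + card (?R B)"
      by (rule card_Un_le)
    also have "\<dots> \<le> 2 ^ j + 2 ^ j"
      using Query.IH by (intro add_mono) auto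
    finally have "card (?R A \<union> ?R B) \<le> 2 ^ k"
      using Suc by simp
    then show ?thesis
      using card_mono[OF fin sub] finite_subset[OF sub fin] by (intro conjI) linarith+
  qed
qed

text \<open>At most \<open>2 ^ k\<close> elements, hence at most half of \<open>S\<close>, can
  finish within \<open>k\<close> queries, because different elements need different outputs. The
  other half pays at least \<open>k\<close> each.\<close>

lemma sum_queries_ge_of_card:
  assumes fin: "finite S"
    and inj: "inj_on (\<lambda>s. result (ask s) A) S"
    and card: "2 * 2 ^ k \<le> card S"
  shows "card S * k \<le> 2 * (\<Sum>s\<in>S. queries (ask s) A)"
proof -
  let ?F = "{s \<in> S. queries (ask s) A \<le> k}" and ?M = "{s \<in> S. \<not> queries (ask s) A \<le> k}"
  let ?R = "{result f A | f. queries f A \<le> k}"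
  have "card ?F = card ((\<lambda>s. result (ask s) A) ` ?F)"
    by (rule card_image[symmetric], rule inj_on_subset[OF inj]) auto
  also have "\<dots> \<le> card ?R"
    using finite_card_results_within by (intro card_mono) auto
  also have "\<dots> \<le> 2 ^ k"
    using finite_card_results_within by blast
  finally have F: "2 * card ?F \<le> card S"
    using card by linarith
  have "card S = card ?F + card ?M"
    using fin by (subst card_Un_disjoint[symmetric]) (auto intro: arg_cong[where f = card])
  with F have "card S \<le> 2 * card ?M" by linarith
  then have "card S * k \<le> 2 * (card ?M * k)"
    by (metis mult.assoc mult_le_mono1)
  also have "card ?M * k \<le> (\<Sum>s\<in>?M. queries (ask s) A)"
    using sum_bounded_below[of ?M k "\<lambda>s. queries (ask s) A"] by simp
  also have "\<dots> \<le> (\<Sum>s\<in>S. queries (ask s) A)"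
    using fin by (intro sum_mono2) auto
  finally show ?thesis by simp
qed

text \<open>All answers agree with those of \<open>f\<close>, except that each hidden pair \<open>e\<close> is revealed by the
  query \<open>e\<close> itself: an algorithm must eliminate the pairs one at a time.\<close>

lemma sum_queries_hidden_pair:
  assumes "finite E"
    and "\<And>x y. (x, y) \<in> E \<Longrightarrow> \<not> f x y"
    and "inj_on (\<lambda>e. result (\<lambda>x y. f x y \<or> (x, y) = e) A) E"
  shows "card E * (card E - 1) \<le> 2 * (\<Sum>e\<in>E. queries (\<lambda>x y. f x y \<or> (x, y) = e) A)"
  using assms
proof (induction A arbitrary: E)
  case (Output R)
  then have "card E \<le> 1"
    by (auto simp: inj_on_def card_le_Suc0_iff_eq)
  then show ?case by (cases "card E") auto
next
  case (Query u v A B)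
  let ?ask = "\<lambda>e x y. f x y \<or> (x, y) = e"
  let ?Q = "\<lambda>X E. \<Sum>e\<in>E. queries (?ask e) X"
  show ?case
  proof (cases "f u v")
    case True
    have "card E * (card E - 1) \<le> 2 * ?Q A E"
      using Query.prems True by (intro Query.IH(1)) auto
    also have "?Q A E \<le> ?Q (Query u v A B) E"
      using True by (intro sum_mono) auto
    finally show ?thesis by simp
  next
    case False
    \<comment> \<open>The query is answered 0 for every hidden pair but \<open>(u, v)\<close>
      itself: it removes at most one candidate, while all others pay 1 and go on in
      \<open>B\<close>.\<close>
    have "card (E - {(u, v)}) * (card (E - {(u, v)}) - 1) \<le> 2 * ?Q B (E - {(u, v)})"
    proof (rule Query.IH(2))
      have "inj_on (\<lambda>e. result (?ask e) (Query u v A B)) (E - {(u, v)})"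
        using Query.prems(3) by (rule inj_on_subset) auto
      moreover have "result (?ask e) (Query u v A B) = result (?ask e) B" if "e \<in> E - {(u, v)}" for e
        using False that by auto
      ultimately show "inj_on (\<lambda>e. result (?ask e) B) (E - {(u, v)})"
        by (simp add: inj_on_def)
    qed (use Query.prems in auto)
    moreover have "?Q (Query u v A B) (E - {(u, v)}) = card (E - {(u, v)}) + ?Q B (E - {(u, v)})"
    proof -
      have "?Q (Query u v A B) (E - {(u, v)}) = (\<Sum>e\<in>E - {(u, v)}. 1 + queries (?ask e) B)"
        using False by (intro sum.cong) auto
      then show ?thesis by (simp only: sum.distrib sum_constant) simp
    qed
    moreover have "?Q (Query u v A B) E \<ge> ?Q (Query u v A B) (E - {(u, v)})"
      using Query.prems by (intro sum_mono2) auto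
    moreover have "card E \<le> Suc (card (E - {(u, v)}))"
      by (metis card_Diff1_le card_Suc_Diff1 Diff_empty Diff_insert0 finite_Diff Query.prems(1) le_Suc_eq order_refl)
    \<comment> \<open>The bound is \<open>0 + 1 + ... + (m - 1)\<close>: adding one pair to
      \<open>c\<close> others raises \<open>c (c - 1) / 2\<close> by exactly the \<open>c\<close>
      queries just paid.\<close>
    moreover have "m * (m - 1) \<le> 2 * q"
      if "c * (c - 1) \<le> 2 * b" "q \<ge> c + b" "m \<le> Suc c" for c b q m :: nat
    proof -
      have "m * (m - 1) \<le> Suc c * c"
        using that(3) by (intro mult_le_mono) auto
      also have "\<dots> = c * (c - 1) + 2 * c"
        by (cases c) auto
      finally show ?thesis using that by linarith
    qed
    ultimately show ?thesis by simp
  qed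
qed

lemma learns_injective:
  assumes "learns A \<G>" "S \<subseteq> \<G>" "inj_on parcs S"
  shows "inj_on (\<lambda>G. result (path_query G) A) S"
  using assms unfolding learns_def inj_on_def by (metis subsetD)

text \<open>An algorithm that asks nothing has one fixed output, which cannot be right for two
  graphs.\<close>

lemma queries_pos:
  assumes "learns A \<G>" "G \<in> \<G>" "H \<in> \<G>" "parcs G \<noteq> parcs H"
  shows "0 < queries ask A"
proof (cases A)
  case (Output E)
  then show ?thesis using assms unfolding learns_def by (metis result.simps(1))
qed auto

section \<open>From averages to worst-case and randomized bounds\<close>

text \<open>The uniform distribution on \<open>S\<close>, with a sum in place of the mean.
  \<open>S\<close> is chosen before \<open>A\<close>: a randomized algorithm mixes many
  \<open>A\<close>, and all of them must be slow on the same family.\<close>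

definition hard_on_average :: "'a pair_pre_digraph set \<Rightarrow> real \<Rightarrow> bool" where
  "hard_on_average \<G> b \<longleftrightarrow> (\<exists>S. finite S \<and> S \<noteq> {} \<and> S \<subseteq> \<G> \<and>
     (\<forall>A. learns A \<G> \<longrightarrow> b * card S \<le> (\<Sum>G\<in>S. real (queries (path_query G) A))))"

lemma hard_on_average_mono:
  assumes "hard_on_average \<G> b" "a \<le> b"
  shows "hard_on_average \<G> a"
proof -
  have "a * card S \<le> b * card S" for S :: "'a pair_pre_digraph set"
    using assms(2) by (rule mult_right_mono) simp
  then show ?thesis
    using assms(1) unfolding hard_on_average_def by (meson order_trans)
qed

text \<open>A maximum is at least the mean. For a randomized algorithm, exchanging the sum over
  \<open>S\<close> with the expectation reduces the claim to the mean for each fixed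
  \<open>A\<close> in the support.\<close>

lemma worst_case_ge_average:
  assumes "hard_on_average \<G> b"
  shows "(\<forall>A. learns A \<G> \<longrightarrow> (\<exists>G\<in>\<G>. b \<le> real (queries (path_query G) A))) \<and>
    (\<forall>P. always_learns P \<G> \<longrightarrow> (\<exists>G\<in>\<G>. ennreal b \<le> expected_queries P G))"
proof -
  obtain S where fin: "finite S" and ne: "S \<noteq> {}" and sub: "S \<subseteq> \<G>"
    and avg: "\<And>A. learns A \<G> \<Longrightarrow> b * card S \<le> (\<Sum>G\<in>S. real (queries (path_query G) A))"
    using assms unfolding hard_on_average_def by blast
  have "\<exists>G\<in>\<G>. b \<le> real (queries (path_query G) A)" if A: "learns A \<G>" for A
  proof (rule ccontr)
    assume "\<not> ?thesis"
    then have "(\<Sum>G\<in>S. real (queries (path_query G) A)) < (\<Sum>G\<in>S. b)"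
      using sub fin ne by (intro sum_strict_mono) (auto simp: not_le)
    with avg[OF A] show False by (simp add: mult.commute)
  qed
  moreover have "\<exists>G\<in>\<G>. ennreal b \<le> expected_queries P G" if P: "always_learns P \<G>" for P
  proof (rule ccontr)
    assume "\<not> ?thesis"
    then have small: "expected_queries P G < ennreal b" if "G \<in> S" for G
      using sub that by (auto simp: not_le)
    \<comment> \<open>Strict inequalities need not survive addition of infinite terms. Under the
      assumption to be refuted all costs are finite, so the strict comparison can be made in the
      reals.\<close>
    have finite_cost: "expected_queries P G < top" if "G \<in> S" for G
      using small[OF that] ennreal_less_top by (rule less_trans)
    have "b > 0"
      using small ne by (metis ennreal_eq_0_iff ex_in_conv not_gr_zero not_less not_less_zero)
    have "ennreal (b * card S) = (\<integral>\<^sup>+ A. ennreal (b * card S) \<partial>measure_pmf P)"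
      by simp
    also have "\<dots> \<le> (\<integral>\<^sup>+ A. (\<Sum>G\<in>S. ennreal (real (queries (path_query G) A))) \<partial>measure_pmf P)"
    proof (rule nn_integral_mono_AE, rule AE_pmfI)
      fix A assume "A \<in> set_pmf P"
      then have "learns A \<G>" using P unfolding always_learns_def by blast
      from avg[OF this] show "ennreal (b * card S) \<le> (\<Sum>G\<in>S. ennreal (real (queries (path_query G) A)))"
        by (subst sum_ennreal) (auto intro: ennreal_leI)
    qed
    also have "\<dots> = (\<Sum>G\<in>S. expected_queries P G)"
      unfolding expected_queries_def by (rule nn_integral_sum) auto
    also have "\<dots> = (\<Sum>G\<in>S. ennreal (enn2real (expected_queries P G)))"
      by (intro sum.cong) (simp_all add: finite_cost)
    also have "\<dots> = ennreal (\<Sum>G\<in>S. enn2real (expected_queries P G))"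
      by (simp add: sum_ennreal)
    also have "\<dots> < ennreal (b * card S)"
    proof (rule ennreal_lessI)
      show "0 < b * card S"
        using \<open>b > 0\<close> fin ne by (simp add: card_gt_0_iff)
      have "(\<Sum>G\<in>S. enn2real (expected_queries P G)) < (\<Sum>G\<in>S. b)"
        using fin ne small by (intro sum_strict_mono) (simp_all add: finite_cost)
      then show "(\<Sum>G\<in>S. enn2real (expected_queries P G)) < b * card S"
        by (simp add: mult.commute)
    qed
    finally show False by simp
  qed
  ultimately show ?thesis by blast
qed

subsection \<open>Relabellings\<close>

definition relabel :: "('a \<Rightarrow> 'b) \<Rightarrow> 'a pair_pre_digraph \<Rightarrow> 'b pair_pre_digraph" where
  "relabel \<pi> G = \<lparr>pverts = \<pi> ` pverts G, parcs = map_prod \<pi> \<pi> ` parcs G\<rparr>"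

lemma relabel_simps [simp]:
  "pverts (relabel \<pi> G) = \<pi> ` pverts G"
  "parcs (relabel \<pi> G) = map_prod \<pi> \<pi> ` parcs G"
  by (simp_all add: relabel_def)

lemma inj_map_prod: "inj \<pi> \<Longrightarrow> inj (map_prod \<pi> \<pi>)"
  by (simp add: prod.inj_map)

lemma arc_relabel_iff: "inj \<pi> \<Longrightarrow> (\<pi> u, \<pi> v) \<in> parcs (relabel \<pi> G) \<longleftrightarrow> (u, v) \<in> parcs G"
  using inj_image_mem_iff[OF inj_map_prod, of \<pi> "(u, v)" "parcs G"] by simp

lemma pcas_relabel_iff: "inj \<pi> \<Longrightarrow> pcas (\<pi> u) (map (map_prod \<pi> \<pi>) p) (\<pi> v) \<longleftrightarrow> pcas u p v"
  by (induction p arbitrary: u) (auto simp: inj_eq)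

lemma pawalk_verts_relabel: "pawalk_verts (\<pi> u) (map (map_prod \<pi> \<pi>) p) = map \<pi> (pawalk_verts u p)"
  by (induction p arbitrary: u) auto

lemma awalk_relabel_iff:
  assumes "inj \<pi>"
  shows "pre_digraph.awalk (with_proj (relabel \<pi> G)) (\<pi> u) (map (map_prod \<pi> \<pi>) p) (\<pi> v) \<longleftrightarrow>
    pre_digraph.awalk (with_proj G) u p v"
  using assms
  by (simp add: pre_digraph.awalk_def cas_with_proj_eq pcas_relabel_iff inj_image_mem_iff
      inj_image_subset_iff inj_map_prod)

lemma apath_relabel_iff:
  assumes "inj \<pi>"
  shows "pre_digraph.apath (with_proj (relabel \<pi> G)) (\<pi> u) (map (map_prod \<pi> \<pi>) p) (\<pi> v) \<longleftrightarrow>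
    pre_digraph.apath (with_proj G) u p v"
  using assms
  by (simp add: pre_digraph.apath_def awalk_relabel_iff awalk_verts_with_proj_eq pawalk_verts_relabel
      distinct_map inj_on_subset[OF _ subset_UNIV])

lemma reachable_relabel:
  assumes "u \<rightarrow>\<^sup>*\<^bsub>with_proj G\<^esub> v"
  shows "\<pi> u \<rightarrow>\<^sup>*\<^bsub>with_proj (relabel \<pi> G)\<^esub> \<pi> v"
  using assms unfolding reachable_def with_proj_simps
proof (induction rule: rtrancl_on_induct)
  case base
  then show ?case by auto
next
  case (step x y)
  then show ?case
    by (intro rtrancl_on_into_rtrancl_on[OF step.IH]) auto
qed

lemma relabel_inv: "inj \<pi> \<Longrightarrow> relabel (inv \<pi>) (relabel \<pi> G) = G"
  by (simp add: relabel_def image_image prod.map_comp o_def map_prod_def case_prod_unfold)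

lemma reachable_relabel_iff:
  assumes "inj \<pi>"
  shows "\<pi> u \<rightarrow>\<^sup>*\<^bsub>with_proj (relabel \<pi> G)\<^esub> \<pi> v \<longleftrightarrow> u \<rightarrow>\<^sup>*\<^bsub>with_proj G\<^esub> v"
  using reachable_relabel[where u = u and v = v and G = G and \<pi> = \<pi>] reachable_relabel[where u = "\<pi> u" and v = "\<pi> v" and G = "relabel \<pi> G" and \<pi> = "inv \<pi>"] assms
  by (auto simp: relabel_inv)

text \<open>As \<open>\<pi>\<close> is onto the whole type, every list of arcs, walk or not, is an
  image. Hence the equivalences above, stated for images only, let arbitrary paths and cycles be
  pulled back.\<close>

lemma walk_relabel_cases:
  assumes "surj \<pi>"
  obtains p where "q = map (map_prod \<pi> \<pi>) p"
proof
  show "q = map (map_prod \<pi> \<pi>) (map (map_prod (inv \<pi>) (inv \<pi>)) q)"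
    using assms by (simp add: prod.map_comp o_def surj_f_inv_f map_prod_def case_prod_unfold)
qed

lemma rooted_dag_relabel:
  assumes "bij \<pi>" "rooted_dag G r"
  shows "rooted_dag (relabel \<pi> G) (\<pi> r)"
proof -
  note inj = bij_is_inj[OF assms(1)] and surj = bij_is_surj[OF assms(1)]
  interpret G: pair_fin_digraph G
    using assms(2) by (simp add: rooted_dag_def)
  have "pair_fin_digraph (relabel \<pi> G)"
    by unfold_locales (auto simp: G.pair_finite_verts G.pair_finite_arcs intro: G.in_arcsD1 G.in_arcsD2)
  moreover have "\<not> pre_digraph.cycle (with_proj (relabel \<pi> G)) q" for q
  proof
    assume q: "pre_digraph.cycle (with_proj (relabel \<pi> G)) q"
    obtain p where p: "q = map (map_prod \<pi> \<pi>) p"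
      using surj by (rule walk_relabel_cases)
    obtain u where u: "pre_digraph.awalk (with_proj (relabel \<pi> G)) u q u"
      "distinct (tl (pawalk_verts u q))" "q \<noteq> []"
      using q by (auto simp: pre_digraph.cycle_def awalk_verts_with_proj_eq)
    obtain w where w: "u = \<pi> w"
      using surj by (metis surjD)
    have "pre_digraph.cycle (with_proj G) p"
      using u unfolding pre_digraph.cycle_def awalk_verts_with_proj_eq p w
      by (auto simp: awalk_relabel_iff[OF inj] pawalk_verts_relabel distinct_map simp flip: map_tl)
    then show False
      using assms(2) by (auto simp: rooted_dag_def)
  qed
  ultimately show ?thesis
    using assms(2) by (auto simp: rooted_dag_def reachable_relabel)
qed

lemma arborescence_relabel:
  assumes "bij \<pi>" "arborescence T r"
  shows "arborescence (relabel \<pi> T) (\<pi> r)"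
  unfolding arborescence_def
proof (intro conjI ballI)
  note inj = bij_is_inj[OF assms(1)] and surj = bij_is_surj[OF assms(1)]
  show "rooted_dag (relabel \<pi> T) (\<pi> r)"
    using assms rooted_dag_relabel by (auto simp: arborescence_def)
  fix w assume "w \<in> pverts (relabel \<pi> T)"
  then obtain v where v: "w = \<pi> v" "v \<in> pverts T" by auto
  obtain p where p: "pre_digraph.apath (with_proj T) r p v"
    and uniq: "\<And>q. pre_digraph.apath (with_proj T) r q v \<Longrightarrow> q = p"
    using assms(2) v(2) unfolding arborescence_def by blast
  show "\<exists>!q. pre_digraph.apath (with_proj (relabel \<pi> T)) (\<pi> r) q w"
  proof (rule ex1I)
    show "pre_digraph.apath (with_proj (relabel \<pi> T)) (\<pi> r) (map (map_prod \<pi> \<pi>) p) w"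
      using p by (simp add: v apath_relabel_iff[OF inj])
    fix q assume q: "pre_digraph.apath (with_proj (relabel \<pi> T)) (\<pi> r) q w"
    obtain p' where p': "q = map (map_prod \<pi> \<pi>) p'"
      using surj by (rule walk_relabel_cases)
    with q uniq show "q = map (map_prod \<pi> \<pi>) p"
      by (simp add: v apath_relabel_iff[OF inj])
  qed
qed

lemma almost_tree_relabel:
  assumes "bij \<pi>" "almost_tree G"
  shows "almost_tree (relabel \<pi> G)"
proof -
  note inj = bij_is_inj[OF assms(1)] and surj = bij_is_surj[OF assms(1)]
  obtain r T s t where G: "rooted_dag G r" "arborescence T r" "cross_edge T s t"
    "pverts G = pverts T" "parcs G = insert (s, t) (parcs T)"
    and trans: "\<And>u v. \<not> transitive_edge G u v"
    using assms(2) unfolding almost_tree_def by blast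
  have "cross_edge (relabel \<pi> T) (\<pi> s) (\<pi> t)"
    using G(3) by (simp add: cross_edge_def reachable_relabel_iff[OF inj])
  moreover have "\<not> transitive_edge (relabel \<pi> G) x y" for x y
  proof
    assume xy: "transitive_edge (relabel \<pi> G) x y"
    obtain u v where uv: "x = \<pi> u" "y = \<pi> v"
      using surj by (metis surjD)
    obtain q where q: "pre_digraph.apath (with_proj (relabel \<pi> G)) x q y" "length q > 1"
      using xy by (auto simp: transitive_edge_def)
    obtain p where p: "q = map (map_prod \<pi> \<pi>) p"
      using surj by (rule walk_relabel_cases)
    have "pre_digraph.apath (with_proj G) u p v" "length p > 1" "(u, v) \<in> parcs G"
      using xy q p by (simp_all add: uv transitive_edge_def apath_relabel_iff[OF inj] arc_relabel_iff[OF inj] del: relabel_simps)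
    then have "transitive_edge G u v"
      by (auto simp: transitive_edge_def)
    then show False using trans by blast
  qed
  moreover have "rooted_dag (relabel \<pi> G) (\<pi> r)" "arborescence (relabel \<pi> T) (\<pi> r)"
    using assms(1) G by (simp_all add: rooted_dag_relabel arborescence_relabel)
  moreover have "pverts (relabel \<pi> G) = pverts (relabel \<pi> T)"
    "parcs (relabel \<pi> G) = insert (\<pi> s, \<pi> t) (parcs (relabel \<pi> T))"
    using G by simp_all
  ultimately show ?thesis
    unfolding almost_tree_def by blast
qed

lemma height_relabel:
  assumes "bij \<pi>"
  shows "height (relabel \<pi> G) = height G"
proof -
  note inj = bij_is_inj[OF assms(1)] and surj = bij_is_surj[OF assms(1)]
  have "{length q | x q y. pre_digraph.apath (with_proj (relabel \<pi> G)) x q y} =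
    {length p | u p v. pre_digraph.apath (with_proj G) u p v}" (is "?L = ?R")
  proof (intro equalityI subsetI)
    fix l assume "l \<in> ?L"
    then obtain x q y where q: "l = length q" "pre_digraph.apath (with_proj (relabel \<pi> G)) x q y"
      by blast
    obtain u v where uv: "x = \<pi> u" "y = \<pi> v"
      using surj by (metis surjD)
    obtain p where p: "q = map (map_prod \<pi> \<pi>) p"
      using surj by (rule walk_relabel_cases)
    have "pre_digraph.apath (with_proj G) u p v" "l = length p"
      using q by (simp_all add: p uv apath_relabel_iff[OF inj])
    then show "l \<in> ?R" by blast
  next
    fix l assume "l \<in> ?R"
    then obtain u p v where p: "l = length p" "pre_digraph.apath (with_proj G) u p v"
      by blast
    then have "pre_digraph.apath (with_proj (relabel \<pi> G)) (\<pi> u) (map (map_prod \<pi> \<pi>) p) (\<pi> v)"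
      "l = length (map (map_prod \<pi> \<pi>) p)"
      by (simp_all add: apath_relabel_iff[OF inj])
    then show "l \<in> ?L" by blast
  qed
  then show ?thesis by (simp add: height_def)
qed

lemma max_degree_relabel:
  assumes "inj \<pi>"
  shows "max_degree (relabel \<pi> G) = max_degree G"
proof -
  have "in_arcs (with_proj (relabel \<pi> G)) (\<pi> v) = map_prod \<pi> \<pi> ` in_arcs (with_proj G) v"
    and "out_arcs (with_proj (relabel \<pi> G)) (\<pi> v) = map_prod \<pi> \<pi> ` out_arcs (with_proj G) v" for v
    using assms by (auto simp: in_arcs_def out_arcs_def inj_eq)
  then have "in_degree (with_proj (relabel \<pi> G)) (\<pi> v) = in_degree (with_proj G) v"
    and "out_degree (with_proj (relabel \<pi> G)) (\<pi> v) = out_degree (with_proj G) v" for v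
    using inj_map_prod[OF assms]
    by (simp_all add: in_degree_def out_degree_def card_image inj_on_subset)
  then show ?thesis
    by (simp add: max_degree_def image_image)
qed

lemma almost_trees_relabel:
  assumes "G \<in> almost_trees n d h" "\<pi> permutes {..<n}"
  shows "relabel \<pi> G \<in> almost_trees n d h"
  using assms permutes_bij[OF assms(2)]
  by (auto simp: almost_trees_def almost_tree_relabel height_relabel max_degree_relabel bij_is_inj permutes_image)

text \<open>Exchange the ends of the cross edge: the relabelled graph contains
  \<open>(t, s)\<close>, which in \<open>G\<close> would close a 2-cycle with
  \<open>(s, t)\<close>.\<close>

lemma almost_trees_not_singleton:
  assumes "G \<in> almost_trees n d h"
  obtains H where "H \<in> almost_trees n d h" "parcs G \<noteq> parcs H"
proof -
  obtain r T s t where G: "rooted_dag G r" "cross_edge T s t"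
    "pverts G = pverts T" "parcs G = insert (s, t) (parcs T)" "pverts G = {..<n}"
    using assms unfolding almost_trees_def almost_tree_def by blast
  interpret pair_fin_digraph G
    using G(1) by (simp add: rooted_dag_def)
  let ?\<pi> = "Transposition.transpose s t"
  have perm: "?\<pi> permutes {..<n}"
    using G by (intro permutes_swap_id) (auto simp: cross_edge_def)
  have st: "s \<noteq> t" "(s, t) \<in> parcs G" "s \<in> pverts G"
    using G by (auto simp: cross_edge_def reachable_def)
  have "(t, s) \<notin> parcs G"
  proof
    assume "(t, s) \<in> parcs G"
    then have "cycle [(s, t), (t, s)]"
      using st by (auto simp: cycle_def awalk_def)
    then show False using G(1) by (auto simp: rooted_dag_def)
  qed
  moreover have "(t, s) \<in> parcs (relabel ?\<pi> G)"
    using st arc_relabel_iff[OF inj_transpose, of s t s t G]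
    by (simp del: relabel_simps)
  ultimately show ?thesis
    using that[OF almost_trees_relabel[OF assms perm]] by blast
qed

lemma hard_on_average_one:
  assumes "almost_trees n d h \<noteq> {}"
  shows "hard_on_average (almost_trees n d h) 1"
proof -
  obtain G where G: "G \<in> almost_trees n d h"
    using assms by blast
  obtain H where H: "H \<in> almost_trees n d h" "parcs G \<noteq> parcs H"
    using G by (rule almost_trees_not_singleton)
  have "1 \<le> real (queries (path_query G) A)" if "learns A (almost_trees n d h)" for A
    using queries_pos[OF that G H(1) H(2), of "path_query G"] by linarith
  then show ?thesis
    unfolding hard_on_average_def using G by (intro exI[of _ "{G}"]) simp
qed

section \<open>Counting the relabellings of a graph of bounded degree\<close>

lemma card_arcs_le:
  assumes "pair_fin_digraph G" "\<And>v. v \<in> pverts G \<Longrightarrow> out_degree (with_proj G) v \<le> d"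
  shows "card (parcs G) \<le> card (pverts G) * d"
proof -
  interpret pair_fin_digraph G by fact
  have "parcs G = (\<Union>v\<in>pverts G. out_arcs G v)"
    by (auto dest: in_arcsD1)
  then have "card (parcs G) \<le> (\<Sum>v\<in>pverts G. card (out_arcs G v))"
    using card_UN_le[OF pair_finite_verts, of "out_arcs G"] by simp
  also have "\<dots> \<le> (\<Sum>v\<in>pverts G. d)"
    using assms(2) by (intro sum_mono) (simp add: out_degree_def)
  finally show ?thesis by simp
qed

lemma degree_le_max_degree:
  assumes "pair_fin_digraph G" "v \<in> pverts G"
  shows "in_degree (with_proj G) v + out_degree (with_proj G) v \<le> max_degree G"
  using assms pair_fin_digraph.pair_finite_verts[OF assms(1)]
  unfolding max_degree_def by (intro Max_ge) auto

text \<open>Naming a head by its rank among the out-neighbours of the tail takes one of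
  \<open>d\<close> values instead of one of \<open>n\<close>. This keeps the data needed besides the
  graph too short to account for \<open>n!\<close>.\<close>

definition arc_rank :: "nat pair_pre_digraph \<Rightarrow> nat \<Rightarrow> nat \<Rightarrow> nat" where
  "arc_rank H w x = card {e \<in> out_arcs (with_proj H) w. snd e < x}"

lemma arc_rank_strict_mono:
  assumes "finite (parcs H)" "(w, x) \<in> parcs H" "x < y"
  shows "arc_rank H w x < arc_rank H w y"
  unfolding arc_rank_def
proof (rule psubset_card_mono)
  show "{e \<in> out_arcs (with_proj H) w. snd e < x} \<subset> {e \<in> out_arcs (with_proj H) w. snd e < y}"
  proof
    show "{e \<in> out_arcs (with_proj H) w. snd e < x} \<subseteq> {e \<in> out_arcs (with_proj H) w. snd e < y}"
      using assms by auto
    have "(w, x) \<in> {e \<in> out_arcs (with_proj H) w. snd e < y}"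
      "(w, x) \<notin> {e \<in> out_arcs (with_proj H) w. snd e < x}"
      using assms by auto
    then show "{e \<in> out_arcs (with_proj H) w. snd e < x} \<noteq> {e \<in> out_arcs (with_proj H) w. snd e < y}"
      by blast
  qed
qed (rule finite_subset[OF _ assms(1)], auto)

lemma arc_rank_less_out_degree:
  assumes "finite (parcs H)" "(w, x) \<in> parcs H"
  shows "arc_rank H w x < out_degree (with_proj H) w"
  unfolding arc_rank_def out_degree_def
proof (rule psubset_card_mono)
  show "finite (out_arcs (with_proj H) w)"
    using assms(1) by (rule rev_finite_subset) auto
  have "(w, x) \<in> out_arcs (with_proj H) w" "(w, x) \<notin> {e \<in> out_arcs (with_proj H) w. snd e < x}"
    using assms by auto
  then show "{e \<in> out_arcs (with_proj H) w. snd e < x} \<subset> out_arcs (with_proj H) w"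
    by blast
qed

text \<open>A relabelling is determined by the relabelled graph, the image of the root, and for each arc
  the rank of the image of its head among the out-neighbours of the image of its tail.\<close>

lemma card_relabelings:
  assumes dag: "rooted_dag G r" and V: "pverts G = {..<n}"
    and deg: "\<And>\<pi> v. \<pi> permutes {..<n} \<Longrightarrow> v < n \<Longrightarrow> out_degree (with_proj (relabel \<pi> G)) v \<le> d"
  shows "fact n \<le> card ((\<lambda>\<pi>. relabel \<pi> G) ` {\<pi>. \<pi> permutes {..<n}}) * (n * d ^ card (parcs G))"
proof -
  interpret pair_fin_digraph G
    using dag by (simp add: rooted_dag_def)
  let ?\<Pi> = "{\<pi>. \<pi> permutes {..<n}}"
  let ?S = "(\<lambda>\<pi>. relabel \<pi> G) ` ?\<Pi>"
  let ?rk = "\<lambda>\<pi>. \<lambda>e\<in>parcs G. arc_rank (relabel \<pi> G) (\<pi> (fst e)) (\<pi> (snd e))"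
  let ?code = "\<lambda>\<pi>. (relabel \<pi> G, \<pi> r, ?rk \<pi>)"
  let ?F = "parcs G \<rightarrow>\<^sub>E {..<d}"
  have fin: "finite (parcs (relabel \<pi> G))" for \<pi>
    by (simp add: pair_finite_arcs)
  have "inj_on ?code ?\<Pi>"
  proof (rule inj_onI)
    fix \<pi> \<sigma> assume perm: "\<pi> \<in> ?\<Pi>" "\<sigma> \<in> ?\<Pi>" and eq: "?code \<pi> = ?code \<sigma>"
    have H: "relabel \<pi> G = relabel \<sigma> G" and root: "\<pi> r = \<sigma> r" and rk: "?rk \<pi> = ?rk \<sigma>"
      using eq unfolding prod.inject by blast+
    \<comment> \<open>Agreement spreads from the root along arcs: if \<open>\<pi>\<close> and
      \<open>\<sigma>\<close> agree on a tail, both heads are out-neighbours of one vertex in one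
      graph, and equal ranks identify them.\<close>
    have "\<pi> v = \<sigma> v" if "r \<rightarrow>\<^sup>*\<^bsub>with_proj G\<^esub> v" for v
      using that
    proof (induction rule: reachable_induct)
      case base
      show ?case by (rule root)
    next
      case (step x y)
      then have xy: "(x, y) \<in> parcs G" by simp
      have arcs: "(\<pi> x, \<pi> y) \<in> parcs (relabel \<pi> G)" "(\<pi> x, \<sigma> y) \<in> parcs (relabel \<pi> G)"
        using xy arc_relabel_iff[OF permutes_inj, of \<pi> _ x y G] arc_relabel_iff[OF permutes_inj, of \<sigma> _ x y G]
          perm step.IH H by (simp_all del: relabel_simps)
      have "arc_rank (relabel \<pi> G) (\<pi> x) (\<pi> y) = arc_rank (relabel \<pi> G) (\<pi> x) (\<sigma> y)"
        using fun_cong[OF rk, of "(x, y)"] xy H step.IH by (simp del: relabel_simps)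
      then show ?case
        using arc_rank_strict_mono[OF fin arcs(1), of "\<sigma> y"] arc_rank_strict_mono[OF fin arcs(2), of "\<pi> y"]
        by (metis linorder_neqE_nat nat_less_le)
    qed
    then have "\<pi> v = \<sigma> v" if "v < n" for v
      using that dag V by (auto simp: rooted_dag_def)
    then show "\<pi> = \<sigma>"
      using perm by (metis ext lessThan_iff mem_Collect_eq permutes_not_in)
  qed
  then have "card ?\<Pi> = card (?code ` ?\<Pi>)"
    by (rule card_image[symmetric])
  also have "\<dots> \<le> card (?S \<times> {..<n} \<times> ?F)"
  proof (rule card_mono)
    show "finite (?S \<times> {..<n} \<times> ?F)"
      using finite_permutations[of "{..<n}"] pair_finite_arcs by (intro finite_cartesian_product finite_PiE) auto
    have "?code \<pi> \<in> ?S \<times> {..<n} \<times> ?F" if \<pi>: "\<pi> permutes {..<n}" for \<pi>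
    proof -
      have "r < n"
        using dag V by (auto simp: rooted_dag_def)
      then have "\<pi> r < n"
        using permutes_in_image[OF \<pi>, of r] by simp
      moreover have "arc_rank (relabel \<pi> G) (\<pi> x) (\<pi> y) < d" if "(x, y) \<in> parcs G" for x y
      proof -
        have "\<pi> x < n"
          using permutes_in_image[OF \<pi>, of x] in_arcsD1[OF that] V by simp
        then show ?thesis
          using arc_rank_less_out_degree[OF fin, of "\<pi> x" "\<pi> y" \<pi>] deg[OF \<pi>, of "\<pi> x"] that
            arc_relabel_iff[OF permutes_inj[OF \<pi>], of x y G] by (simp del: relabel_simps)
      qed
      ultimately show ?thesis
        using \<pi> by (auto simp del: relabel_simps)
    qed
    then show "?code ` ?\<Pi> \<subseteq> ?S \<times> {..<n} \<times> ?F" by blast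
  qed
  also have "\<dots> = card ?S * (n * d ^ card (parcs G))"
    by (simp add: card_cartesian_product card_PiE pair_finite_arcs del: relabel_simps)
  finally show ?thesis
    by (simp add: card_permutations)
qed

text \<open>The half of Stirling's estimate that is needed. The induction step amounts to
  \<open>n (ln (n + 1) - ln n) \<le> 1\<close>.\<close>

lemma ln_fact_ge: "real n * ln (real n) - real n \<le> ln (fact n)"
proof (induction n)
  case 0
  then show ?case by simp
next
  case (Suc n)
  show ?case
  proof (cases "n = 0")
    case False
    have "ln (real (Suc n)) - ln (real n) = ln (real (Suc n) / real n)"
      using False by (simp add: ln_div)
    also have "real (Suc n) / real n = 1 + 1 / real n"
      using False by (simp add: field_simps)
    also have "ln (1 + 1 / real n) \<le> 1 / real n"
      using ln_add_one_self_le_self[of "1 / real n"] by simp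
    finally have "real n * (ln (real (Suc n)) - ln (real n)) \<le> 1"
      using False by (simp add: field_simps)
    moreover have "ln (fact (Suc n)) = ln (real (Suc n)) + ln (fact n)"
      by (simp add: ln_mult del: of_nat_Suc)
    ultimately show ?thesis
      using Suc by (simp add: algebra_simps)
  qed simp
qed

text \<open>The factor 2 is a crude bound for \<open>1 / ln 2\<close>.\<close>

lemma log2_fact_ge: "real n * log 2 (real n) - 2 * real n \<le> log 2 (fact n)"
proof -
  have "1 / 2 \<le> ln (2::real)"
    using exp_half_le2 by (subst ln_ge_iff) auto
  then have "1 \<le> 2 * ln (2::real)"
    by simp
  then have "(real n * ln (real n) - 2 * real n * ln 2) / ln 2 \<le> ln (fact n) / ln 2"
    using ln_fact_ge[of n] mult_left_mono[of 1 "2 * ln 2" "real n"]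
    by (intro divide_right_mono) auto
  then show ?thesis
    by (simp add: log_def diff_divide_distrib)
qed

lemma log2_le_self: "0 < n \<Longrightarrow> log 2 (real n) \<le> real n"
  using less_exp[of n] by (subst log_le_iff) (simp_all add: powr_realpow less_imp_le)

text \<open>Of the \<open>n log n - 2 n\<close> bits of \<open>n!\<close>, a code spends
  \<open>log n + n d log d\<close> on the root and the ranks. The hypothesis \<open>large\<close>
  makes all losses, with 2 to spare, at most half of \<open>n log n\<close>; averaging halves once
  more, hence the 4.\<close>

lemma hard_on_average_n_log_n:
  assumes d: "1 \<le> d" and n: "0 < n" and ne: "almost_trees n d h \<noteq> {}"
    and large: "10 + 2 * real d * log 2 (real d) \<le> log 2 (real n)"
  shows "hard_on_average (almost_trees n d h) (real n * log 2 (real n) / 4)"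
proof -
  obtain G where G: "G \<in> almost_trees n d h"
    using ne by blast
  then obtain r where dag: "rooted_dag G r" and V: "pverts G = {..<n}"
    by (auto simp: almost_trees_def almost_tree_def)
  interpret pair_fin_digraph G
    using dag by (simp add: rooted_dag_def)
  define S where "S = (\<lambda>\<pi>. relabel \<pi> G) ` {\<pi>. \<pi> permutes {..<n}}"
  have sub: "S \<subseteq> almost_trees n d h"
    unfolding S_def using almost_trees_relabel[OF G] by blast
  have fin: "finite S"
    unfolding S_def using finite_permutations[of "{..<n}"] by simp
  have deg: "out_degree (with_proj H) v \<le> d" if "H \<in> almost_trees n d h" "v < n" for H v
  proof -
    have "pair_fin_digraph H" "v \<in> pverts H" "max_degree H = d"
      using that by (auto simp: almost_trees_def almost_tree_def rooted_dag_def)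
    with degree_le_max_degree[of H v] show ?thesis by linarith
  qed
  have "card (parcs G) \<le> n * d"
    using card_arcs_le[OF pair_fin_digraph, of d] deg[OF G] V by simp
  then have "n * d ^ card (parcs G) \<le> n * d ^ (n * d)"
    using d by (intro mult_left_mono power_increasing) auto
  moreover have "fact n \<le> card S * (n * d ^ card (parcs G))"
    unfolding S_def using dag V deg almost_trees_relabel[OF G] by (intro card_relabelings) auto
  ultimately have "fact n \<le> card S * (n * d ^ (n * d))"
    using mult_le_mono2 order_trans by blast
  then have fact_le: "(fact n :: real) \<le> card S * (real n * real d ^ (n * d))"
    by (metis of_nat_fact of_nat_le_iff of_nat_mult of_nat_power)
  have S_pos: "0 < card S"
    using fact_le by (metis fact_gt_zero gr0I mult_zero_left not_less of_nat_0)
  have "log 2 (fact n) \<le> log 2 (card S * (real n * real d ^ (n * d)))"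
    using fact_le by (intro log_mono) auto
  also have "\<dots> = log 2 (card S) + (log 2 n + real n * (real d * log 2 d))"
    using S_pos n d by (simp add: log_mult log_nat_power)
  finally have "real n * log 2 (real n) - 2 * real n - log 2 n - real n * (real d * log 2 d) \<le> log 2 (card S)"
    using log2_fact_ge[of n] by linarith
  moreover have "real n * (10 + 2 * real d * log 2 (real d)) \<le> real n * log 2 (real n)"
    using large by (rule mult_left_mono) simp
  then have "10 * real n + 2 * (real n * (real d * log 2 (real d))) \<le> real n * log 2 (real n)"
    by (simp add: algebra_simps)
  moreover have "log 2 (real n) \<le> real n"
    using n by (rule log2_le_self)
  moreover have "1 \<le> real n"
    using n by simp
  ultimately have log_S: "real n * log 2 (real n) / 2 + 2 \<le> log 2 (card S)"
    by linarith
  \<comment> \<open>The 1 provides the factor 2 in \<open>2 * 2 ^ k \<le> card S\<close>, and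
    rounding costs less than another 1; together they use up the 2 in \<open>log_S\<close>.\<close>
  define k where "k = nat \<lfloor>log 2 (card S) - 1\<rfloor>"
  have L: "0 \<le> log 2 (real n)"
    using n by simp
  have k: "real n * log 2 (real n) / 2 \<le> real k" "real k \<le> log 2 (card S) - 1"
    using log_S mult_nonneg_nonneg[of "real n", OF _ L] unfolding k_def by linarith+
  have "(2::real) ^ Suc k = 2 powr (real k + 1)"
    by (simp add: powr_add powr_realpow)
  also have "\<dots> \<le> 2 powr (log 2 (card S))"
    using k(2) by simp
  also have "\<dots> = card S"
    using S_pos by simp
  finally have card_S: "2 * 2 ^ k \<le> card S"
    by (metis numeral_power_le_of_nat_cancel_iff power_Suc)
  have inj: "inj_on parcs S"
    using sub by (intro inj_onI pair_pre_digraph.equality) (auto simp: almost_trees_def)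
  have "real n * log 2 (real n) / 4 * card S \<le> (\<Sum>G\<in>S. real (queries (path_query G) A))"
    if A: "learns A (almost_trees n d h)" for A
  proof -
    have "real (card S * k) \<le> real (2 * (\<Sum>G\<in>S. queries (path_query G) A))"
      using sum_queries_ge_of_card[OF fin learns_injective[OF A sub inj] card_S] of_nat_le_iff by blast
    moreover have "card S * (real n * log 2 (real n) / 2) \<le> card S * real k"
      using k(1) by (rule mult_left_mono) simp
    ultimately show ?thesis
      by (simp add: algebra_simps)
  qed
  moreover have "S \<noteq> {}"
    using S_pos by auto
  ultimately show ?thesis
    unfolding hard_on_average_def using fin sub by blast
qed

subsection \<open>Trees with a cross edge\<close>

text \<open>A potential that grows along arcs bounds the length of walks. With \<open>id\<close> it
  excludes cycles and walks back, with \<open>depth\<close> it bounds the height.\<close>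

lemma pcas_potential:
  fixes \<phi> :: "'a \<Rightarrow> nat"
  assumes "\<And>u v. (u, v) \<in> parcs G \<Longrightarrow> \<phi> u < \<phi> v" "set p \<subseteq> parcs G" "pcas u p v"
  shows "\<phi> u + length p \<le> \<phi> v"
  using assms(2,3)
proof (induction p arbitrary: u)
  case (Cons e p)
  then have "(u, snd e) \<in> parcs G"
    by (cases e) simp
  with Cons assms(1) show ?case by fastforce
qed simp

lemma awalk_potential:
  fixes \<phi> :: "'a \<Rightarrow> nat"
  assumes "\<And>u v. (u, v) \<in> parcs G \<Longrightarrow> \<phi> u < \<phi> v" "pre_digraph.awalk (with_proj G) u p v"
  shows "\<phi> u + length p \<le> \<phi> v"
  using assms by (intro pcas_potential[of G]) (auto simp: pre_digraph.awalk_def cas_with_proj_eq)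

text \<open>The labels are a topological order; going back along arcs strictly decreases them and
  can only stop at 0.\<close>

lemma rooted_dag_increasing:
  fixes G :: "nat pair_pre_digraph"
  assumes V: "pverts G = {..<n}" and n: "0 < n"
    and arcs: "\<And>u v. (u, v) \<in> parcs G \<Longrightarrow> u < v \<and> v < n"
    and par: "\<And>v. 0 < v \<Longrightarrow> v < n \<Longrightarrow> \<exists>u. (u, v) \<in> parcs G"
  shows "rooted_dag G 0"
proof -
  have "parcs G \<subseteq> {..<n} \<times> {..<n}"
    using arcs by fastforce
  then have fin: "finite (parcs G)"
    by (rule finite_subset) simp
  have dag: "pair_fin_digraph G"
    by unfold_locales (use V fin arcs in fastforce)+
  then interpret pair_fin_digraph G .
  have "\<not> cycle c" for c
  proof
    assume "cycle c"
    then obtain u where "awalk u c u" "c \<noteq> []"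
      by (auto simp: cycle_def)
    then show False
      using awalk_potential[of G id u c u] arcs by simp
  qed
  moreover have "v < n \<Longrightarrow> 0 \<rightarrow>\<^sup>*\<^bsub>with_proj G\<^esub> v" for v
  proof (induction v rule: less_induct)
    case (less v)
    show ?case
    proof (cases "v = 0")
      case False
      then obtain u where u: "(u, v) \<in> parcs G"
        using par less.prems by auto
      then have "0 \<rightarrow>\<^sup>*\<^bsub>with_proj G\<^esub> u"
        using arcs[OF u] by (intro less.IH) auto
      then show ?thesis
        using u by (rule reachable_adj_trans)
    qed (use V n in simp)
  qed
  ultimately show ?thesis
    using dag V n by (auto simp: rooted_dag_def)
qed

text \<open>Compared from the end, two walks must share their last arc, since no vertex has two
  incoming arcs. Monotonicity excludes that just one of them is empty.\<close>

lemma awalk_unique_increasing: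
  fixes G :: "nat pair_pre_digraph"
  assumes wf: "pair_wf_digraph G"
    and arcs: "\<And>u v. (u, v) \<in> parcs G \<Longrightarrow> u < v"
    and uniq: "\<And>u w v. (u, v) \<in> parcs G \<Longrightarrow> (w, v) \<in> parcs G \<Longrightarrow> u = w"
    and p: "pre_digraph.awalk (with_proj G) u p v" and q: "pre_digraph.awalk (with_proj G) u q v"
  shows "p = q"
  using p q
proof (induction p arbitrary: q v rule: rev_induct)
  case Nil
  interpret pair_wf_digraph G by (rule wf)
  have "u = v"
    using Nil.prems(1) by (simp add: awalk_Nil_iff)
  then show ?case
    using awalk_potential[of G id u q v] arcs Nil.prems(2) by simp
next
  case (snoc e p)
  interpret pair_wf_digraph G by (rule wf)
  have "u + length (p @ [e]) \<le> v"
    using awalk_potential[of G id u "p @ [e]" v] arcs snoc.prems(1) by simp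
  then have "q \<noteq> []"
    using snoc.prems(2) by (auto simp: awalk_Nil_iff)
  then obtain f q' where q': "q = q' @ [f]"
    by (metis append_butlast_last_id)
  obtain "awalk u p (fst e)" "e \<in> parcs G" "snd e = v"
    using snoc.prems(1) by (auto simp: awalk_simps)
  moreover obtain "awalk u q' (fst f)" "f \<in> parcs G" "snd f = v"
    using snoc.prems(2) by (auto simp: q' awalk_simps)
  moreover have "e = f"
    using calculation uniq[of "fst e" v "fst f"] by (metis prod.collapse)
  ultimately show ?case
    using snoc.IH q' by simp
qed

text \<open>The lower bound on the later vertices is what the induction needs to separate them from
  \<open>u\<close>.\<close>

lemma distinct_awalk_increasing:
  fixes G :: "nat pair_pre_digraph"
  assumes "\<And>u v. (u, v) \<in> parcs G \<Longrightarrow> u < v" "set p \<subseteq> parcs G" "pcas u p v"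
  shows "distinct (pawalk_verts u p) \<and> (\<forall>x\<in>set (pawalk_verts u p). u \<le> x)"
  using assms(2,3)
proof (induction p arbitrary: u)
  case (Cons e p)
  have "u < snd e"
    using Cons.prems by (cases e) (auto intro: assms(1))
  with Cons show ?case by fastforce
qed simp

text \<open>With \<open>par v < v\<close> for all \<open>v > 0\<close>, the parent function \<open>par\<close> encodes a tree with root 0;
  its value at 0 is irrelevant.\<close>

definition crossed_tree :: "nat \<Rightarrow> (nat \<Rightarrow> nat) \<Rightarrow> (nat \<times> nat) set \<Rightarrow> nat pair_pre_digraph" where
  "crossed_tree n par E = \<lparr>pverts = {..<n}, parcs = {(par v, v) | v. 0 < v \<and> v < n} \<union> E\<rparr>"

lemma crossed_tree_simps [simp]:
  "pverts (crossed_tree n par E) = {..<n}"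
  "parcs (crossed_tree n par E) = {(par v, v) | v. 0 < v \<and> v < n} \<union> E"
  by (simp_all add: crossed_tree_def)

text \<open>Conditions under which \<open>(s, t)\<close> can be added without a trace in other
  queries: nothing lies below \<open>s\<close> or \<open>t\<close> in the tree, and whatever is
  strictly above \<open>s\<close> is above \<open>t\<close> already. \<open>s < par t\<close> keeps
  \<open>par t\<close> from being an ancestor of \<open>s\<close>, which would make the tree arc
  \<open>(par t, t)\<close> transitive.\<close>

locale crossing =
  fixes n :: nat and par :: "nat \<Rightarrow> nat" and s t :: nat
  assumes par_less: "\<And>v. 0 < v \<Longrightarrow> v < n \<Longrightarrow> par v < v"
    and s_pos: "0 < s" and st: "s < t" and t_less: "t < n"
    and s_leaf: "\<And>v. 0 < v \<Longrightarrow> v < n \<Longrightarrow> par v \<noteq> s"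
    and t_leaf: "\<And>v. 0 < v \<Longrightarrow> v < n \<Longrightarrow> par v \<noteq> t"
    and s_less_par_t: "s < par t"
    and par_s_t: "par s \<rightarrow>\<^sup>*\<^bsub>with_proj (crossed_tree n par {})\<^esub> t"
begin

abbreviation "T \<equiv> crossed_tree n par {}"
abbreviation "G \<equiv> crossed_tree n par {(s, t)}"

lemma arcs_G: "(u, v) \<in> parcs G \<Longrightarrow> u < v \<and> v < n"
  using par_less st t_less by auto

lemma rooted_dag_T: "rooted_dag T 0"
  using par_less t_less by (intro rooted_dag_increasing[where n = n]) auto

lemma rooted_dag_G: "rooted_dag G 0"
  using arcs_G t_less by (intro rooted_dag_increasing[where n = n]) auto

sublocale T: pair_fin_digraph T
  using rooted_dag_T by (simp add: rooted_dag_def)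

sublocale G: pair_fin_digraph G
  using rooted_dag_G by (simp add: rooted_dag_def)

lemma arborescence_T: "arborescence T 0"
  unfolding arborescence_def
proof (intro conjI ballI rooted_dag_T)
  fix v assume "v \<in> pverts T"
  then have "0 \<rightarrow>\<^sup>*\<^bsub>with_proj T\<^esub> v"
    using rooted_dag_T unfolding rooted_dag_def by blast
  then obtain p where p: "T.apath 0 p v"
    using T.reachable_apath by blast
  show "\<exists>!p. T.apath 0 p v"
  proof (rule ex1I[where a = p])
    show "T.apath 0 p v" by (rule p)
    fix q assume "T.apath 0 q v"
    show "q = p"
    proof (rule awalk_unique_increasing[OF T.pair_wf_digraph_axioms])
      show "T.awalk 0 q v" "T.awalk 0 p v"
        using \<open>T.apath 0 q v\<close> p T.awalkI_apath by blast+
    qed (use par_less in auto)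
  qed
qed

lemma reachable_T_le: "u \<rightarrow>\<^sup>*\<^bsub>with_proj T\<^esub> v \<Longrightarrow> u \<le> v"
proof (induction rule: T.reachable_induct)
  case (step x y)
  then have "x < y" using par_less by auto
  with step.IH show ?case by simp
qed simp

lemma reachable_T_from_s: "s \<rightarrow>\<^sup>*\<^bsub>with_proj T\<^esub> v \<longleftrightarrow> v = s"
proof
  assume "s \<rightarrow>\<^sup>*\<^bsub>with_proj T\<^esub> v"
  then show "v = s"
  proof (cases rule: T.converse_reachable_cases)
    case (step w)
    then show ?thesis using s_leaf by auto
  qed simp
qed (use st t_less in simp)

lemma cross_edge_T: "cross_edge T s t"
  using st t_less reachable_T_le[of t s] by (auto simp: cross_edge_def reachable_T_from_s)

text \<open>A longer path from \<open>u\<close> to \<open>v\<close> enters \<open>v\<close> by a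
  second arc, from some \<open>w > u\<close>. Only \<open>t\<close> has two incoming arcs, so
  \<open>u = s\<close> and \<open>w = par t\<close>; but a walk leaving \<open>s\<close> must go to
  \<open>t\<close>, which is already beyond \<open>par t\<close>.\<close>

lemma not_transitive_G: "\<not> transitive_edge G u v"
proof
  assume "transitive_edge G u v"
  then obtain p where p: "G.apath u p v" "length p > 1" and uv: "(u, v) \<in> parcs G"
    by (auto simp: transitive_edge_def)
  then obtain e q where q: "p = q @ [e]" "q \<noteq> []"
    by (cases p rule: rev_cases) auto
  have "G.awalk u (q @ [e]) v"
    using G.awalkI_apath[OF p(1)] unfolding q(1) .
  then obtain w where w: "G.awalk u q w" "(w, v) \<in> parcs G"
    by (cases e) (auto simp: G.awalk_append_iff G.awalk_simps simp del: crossed_tree_simps)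
  have "u + length q \<le> w"
    using awalk_potential[of G id u q w] arcs_G w(1) by (simp del: crossed_tree_simps)
  then have "u < w" using q(2) by (cases q) auto
  then have "u = s" "w = par t" "v = t"
    using uv w(2) s_less_par_t by auto
  moreover obtain f q' where "q = f # q'"
    using q(2) by (cases q) auto
  ultimately have "f \<in> parcs G" "fst f = s" "G.awalk (snd f) q' (par t)"
    using w(1) by (auto simp: G.awalk_simps simp del: crossed_tree_simps)
  moreover have "snd f = t"
    using \<open>f \<in> parcs G\<close> \<open>fst f = s\<close> s_leaf by (cases f) auto
  ultimately have "t + length q' \<le> par t"
    using awalk_potential[of G id t q' "par t"] arcs_G by (simp del: crossed_tree_simps)
  then show False
    using par_less[of t] st t_less by simp
qed

lemma almost_tree_G: "almost_tree G"
proof -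
  have "parcs G = insert (s, t) (parcs T)" "pverts G = pverts T"
    by auto
  then show ?thesis
    unfolding almost_tree_def
    using rooted_dag_G arborescence_T cross_edge_T not_transitive_G by blast
qed

text \<open>Every ancestor of \<open>s\<close> other than \<open>s\<close> itself is already an ancestor of \<open>t\<close>, and \<open>t\<close> is a leaf,
  so that the cross edge changes the answer to a single query.\<close>

lemma path_query_G: "path_query G x y \<longleftrightarrow> path_query T x y \<or> (x, y) = (s, t)"
proof
  assume "path_query G x y"
  then have "x \<rightarrow>\<^sup>*\<^bsub>with_proj G\<^esub> y"
    by (simp add: path_query_def)
  then show "path_query T x y \<or> (x, y) = (s, t)"
    unfolding path_query_def
  proof (induction rule: G.reachable_induct)
    case base
    then show ?case by simp
  next
    case (step y z)
    then consider "(y, z) \<in> parcs T" | "y = s" "z = t"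
      by auto
    then show ?case
    proof cases
      case 1
      then have "y \<noteq> t" using t_leaf by auto
      with step.IH have "x \<rightarrow>\<^sup>*\<^bsub>with_proj T\<^esub> y" by simp
      then have "x \<rightarrow>\<^sup>*\<^bsub>with_proj T\<^esub> z"
        using 1 by (rule T.reachable_adj_trans)
      then show ?thesis by simp
    next
      case 2
      have "x \<rightarrow>\<^sup>*\<^bsub>with_proj T\<^esub> s"
        using step.IH 2 st by simp
      \<comment> \<open>The only way into \<open>s\<close> is from \<open>par s\<close>, which
        reaches \<open>t\<close> in the tree. The variable \<open>v\<close> is there for the
        induction.\<close>
      moreover have "x \<rightarrow>\<^sup>*\<^bsub>with_proj T\<^esub> v \<Longrightarrow> v = s \<Longrightarrow> x = s \<or> x \<rightarrow>\<^sup>*\<^bsub>with_proj T\<^esub> par s" for v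
        by (induction rule: T.reachable_induct) auto
      ultimately consider "x = s" | "x \<rightarrow>\<^sup>*\<^bsub>with_proj T\<^esub> par s"
        by blast
      then show ?thesis
        using 2 par_s_t T.reachable_trans by cases blast+
    qed
  qed
next
  have "x \<rightarrow>\<^sup>*\<^bsub>with_proj G\<^esub> y" if "x \<rightarrow>\<^sup>*\<^bsub>with_proj T\<^esub> y"
    using that
  proof (induction rule: T.reachable_induct)
    case (step y z)
    then show ?case
      using G.reachable_adj_trans[of x y z] by auto
  qed simp
  moreover assume "path_query T x y \<or> (x, y) = (s, t)"
  ultimately show "path_query G x y"
    using G.reachable_adjI[of s t] by (auto simp: path_query_def)
qed

lemma in_degree_G: "in_degree (with_proj G) v \<le> (if v = 0 then 0 else if v = t then 2 else 1)"
proof -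
  have "in_arcs (with_proj G) v \<subseteq> (if v = 0 then {} else if v = t then {(par v, v), (s, t)} else {(par v, v)})"
    using st by (auto simp: in_arcs_def)
  then have "card (in_arcs (with_proj G) v) \<le>
    card (if v = 0 then {} else if v = t then {(par v, v), (s, t)} else {(par v, v)})"
    by (rule card_mono[rotated]) auto
  also have "\<dots> \<le> (if v = 0 then 0 else if v = t then 2 else 1)"
    by (auto simp: card_insert_if)
  finally show ?thesis by (simp only: in_degree_def)
qed

lemma out_degree_G:
  "out_degree (with_proj G) v = card {c. 0 < c \<and> c < n \<and> par c = v} + (if v = s then 1 else 0)"
proof -
  let ?C = "{c. 0 < c \<and> c < n \<and> par c = v}"
  have eq: "out_arcs (with_proj G) v = Pair v ` ?C \<union> (if v = s then {(s, t)} else {})"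
    by (auto simp: out_arcs_def)
  have "Pair v ` ?C \<inter> (if v = s then {(s, t)} else {}) = {}"
    using s_leaf by auto
  then have "card (out_arcs (with_proj G) v) = card (Pair v ` ?C) + card (if v = s then {(s, t)} else {})"
    unfolding eq by (intro card_Un_disjoint) auto
  then show ?thesis
    by (simp add: out_degree_def card_image inj_on_def)
qed

end

subsection \<open>The hard family of large height\<close>

text \<open>The tree consists of a path \<open>0, \<dots>, h\<close>, leaves \<open>h + i\<close> below the path vertices
  \<open>i = 1, \<dots>, B\<close>, further \<open>d - 1\<close> leaves below the root, which give it degree \<open>d\<close>, and a binary
  heap on the vertices \<open>q + 1, \<dots>, n - 1\<close> attached to the path vertex \<open>B + 1\<close>, whose \<open>k\<close>-th
  vertex is \<open>q + k\<close>.\<close>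

locale comb_heap =
  fixes n d h B q :: nat
  assumes d: "3 \<le> d" and q: "q = h + B + d - 1" and n: "q + 2 < n"
    and B: "B + 2 + floor_log n \<le> h"
begin

text \<open>The heap hangs just past the last path vertex with a tooth, so the parent of every tooth
  is an ancestor of the whole heap. Vertices other than the root have at most two children.\<close>

definition par :: "nat \<Rightarrow> nat" where
  "par v = (if v \<le> h then v - 1 else if v \<le> h + B then v - h else if v \<le> q then 0
    else if v = Suc q then Suc B else q + (v - q) div 2)"

text \<open>The distance from the root in the base tree in closed form, used as a potential.\<close>

definition depth :: "nat \<Rightarrow> nat" where
  "depth v = (if v \<le> h then v else if v \<le> h + B then Suc (v - h) else if v \<le> q then 1
    else B + 2 + floor_log (v - q))"

definition teeth :: "nat set" where
  "teeth = {h<..h + B}"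

text \<open>The children of \<open>v = q + k\<close> would be \<open>q + 2 k = 2 v - q\<close> and
  its successor, so \<open>v\<close> is a leaf iff \<open>2 v \<ge> n + q\<close>.\<close>

definition heap_leaves :: "nat set" where
  "heap_leaves = {(n + q + 1) div 2..<n}"

abbreviation "base \<equiv> crossed_tree n par {}"

lemma q_ge: "h + B + 2 \<le> q"
  using q d by simp

lemma par_less: "0 < v \<Longrightarrow> par v < v"
  using q_ge B by (auto simp: par_def)

lemma teethD: "s \<in> teeth \<Longrightarrow> h < s \<and> s \<le> h + B \<and> s \<le> q"
  using q_ge by (auto simp: teeth_def)

text \<open>By \<open>q + 2 < n\<close> the heap has at least two vertices, so its root
  \<open>Suc q\<close> is not a leaf and the parent of a heap leaf lies in the heap.\<close>

lemma heap_leavesD: "t \<in> heap_leaves \<Longrightarrow> Suc q < t \<and> t < n \<and> n + q \<le> 2 * t"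
  using n by (auto simp: heap_leaves_def)

lemma depth_par_less:
  assumes "0 < v"
  shows "depth (par v) < depth v"
proof -
  consider "v \<le> h" | "h < v" "v \<le> h + B" | "h + B < v" "v \<le> q" | "v = Suc q" | "Suc q < v"
    by linarith
  then show ?thesis
  proof cases
    case 1
    then have "v - 1 \<le> h" "v - 1 < v" using assms by simp_all
    then show ?thesis using 1 by (simp add: par_def depth_def)
  next
    case 2
    then have "v - h \<le> h" using B by linarith
    then show ?thesis using 2 by (simp add: par_def depth_def)
  next
    case 3
    then show ?thesis using B by (simp add: par_def depth_def)
  next
    case 4
    then show ?thesis using q_ge B by (simp add: par_def depth_def)
  next
    case 5
    define k where "k = v - q"
    have k: "v = q + k" "2 \<le> k"
      using 5 by (simp_all add: k_def)
    have depth_heap: "depth (q + j) = B + 2 + floor_log j" if "1 \<le> j" for j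
      using that q_ge by (simp add: depth_def)
    have "par v = q + k div 2"
      using k q_ge by (simp add: par_def)
    moreover have "1 \<le> k div 2"
      using k(2) by linarith
    ultimately show ?thesis
      using k floor_log_rec[OF k(2)] by (simp add: depth_heap)
  qed
qed

lemma depth_le:
  assumes "v < n"
  shows "depth v \<le> h"
proof -
  have "floor_log (v - q) \<le> floor_log n"
    by (rule floor_log_le_iff) (use assms in simp)
  then show ?thesis using B by (auto simp: depth_def)
qed

lemma base_pair_fin_digraph: "pair_fin_digraph base"
proof -
  have "rooted_dag base 0"
    using par_less n by (intro rooted_dag_increasing[where n = n]) auto
  then show ?thesis by (simp add: rooted_dag_def)
qed

lemma reachable_path:
  assumes "i \<le> j" "j \<le> h"
  shows "i \<rightarrow>\<^sup>*\<^bsub>with_proj base\<^esub> j"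
  using assms
proof (induction j rule: dec_induct)
  case base
  interpret pair_fin_digraph base by (rule base_pair_fin_digraph)
  show ?case using base q_ge n by simp
next
  case (step j)
  interpret pair_fin_digraph base by (rule base_pair_fin_digraph)
  have "(j, Suc j) \<in> parcs base"
    using step q_ge n by (auto simp: par_def)
  with step show ?case
    using reachable_adj_trans by simp
qed

lemma reachable_heap: "q < v \<Longrightarrow> v < n \<Longrightarrow> Suc B \<rightarrow>\<^sup>*\<^bsub>with_proj base\<^esub> v"
proof (induction v rule: less_induct)
  case (less v)
  interpret pair_fin_digraph base by (rule base_pair_fin_digraph)
  have "Suc B \<rightarrow>\<^sup>*\<^bsub>with_proj base\<^esub> par v"
  proof (cases "v = Suc q")
    case True
    then show ?thesis using q_ge n by (auto simp: par_def)
  next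
    case False
    then have "q < par v" "par v < v"
      using less.prems q_ge par_less by (auto simp: par_def)
    then show ?thesis using less by simp
  qed
  moreover have "(par v, v) \<in> parcs base"
    using less.prems by auto
  ultimately show ?case by (rule reachable_adj_trans)
qed

lemma children_tooth: "h < v \<Longrightarrow> v \<le> q \<Longrightarrow> 0 < c \<Longrightarrow> par c \<noteq> v"
  using B q_ge by (auto simp: par_def)

lemma children_heap: "q < v \<Longrightarrow> 0 < c \<Longrightarrow> par c = v \<Longrightarrow> c = 2 * v - q \<or> c = Suc (2 * v - q)"
  using B q_ge by (auto simp: par_def split: if_splits)

lemma crossing:
  assumes "s \<in> teeth" "t \<in> heap_leaves"
  shows "crossing n par s t"
proof
  note s = teethD[OF assms(1)] and t = heap_leavesD[OF assms(2)]
  show "par v < v" if "0 < v" for v using that by (rule par_less)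
  show "0 < s" "s < t" "t < n" using s t by auto
  show "par v \<noteq> s" if "0 < v" for v
    using children_tooth[of s v] s that by simp
  show "par v \<noteq> t" if "0 < v" "v < n" for v
    using children_heap[of t v] t that by auto
  show "s < par t"
    using s t q_ge by (auto simp: par_def)
  interpret pair_fin_digraph base by (rule base_pair_fin_digraph)
  have "par s \<rightarrow>\<^sup>*\<^bsub>with_proj base\<^esub> Suc B"
    using s B by (intro reachable_path) (auto simp: par_def)
  also have "Suc B \<rightarrow>\<^sup>*\<^bsub>with_proj base\<^esub> t"
    using t by (intro reachable_heap) auto
  finally show "par s \<rightarrow>\<^sup>*\<^bsub>with_proj base\<^esub> t" .
qed

lemma children_root: "{c. 0 < c \<and> c < n \<and> par c = 0} = insert 1 {h + B<..q}"
  using B q_ge n by (auto simp: par_def split: if_splits)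

lemma children_path:
  assumes "0 < v" "v \<le> h"
  shows "{c. 0 < c \<and> c < n \<and> par c = v} \<subseteq> {Suc v, if v = Suc B then Suc q else h + v}"
  using assms B q_ge by (auto simp: par_def split: if_splits)

lemma card_children_le:
  assumes "0 < v"
  shows "card {c. 0 < c \<and> c < n \<and> par c = v} \<le> 2"
proof -
  have two: "card {a, b} \<le> 2" for a b :: nat
    by (simp add: card_insert_if)
  consider "v \<le> h" | "h < v" "v \<le> q" | "q < v"
    by linarith
  then show ?thesis
  proof cases
    case 1
    then show ?thesis
      using card_mono[OF _ children_path[OF assms]] two order_trans by blast
  next
    case 2
    then have none: "{c. 0 < c \<and> c < n \<and> par c = v} = {}"
      using children_tooth by auto
    show ?thesis unfolding none by simp
  next
    case 3
    then have "{c. 0 < c \<and> c < n \<and> par c = v} \<subseteq> {2 * v - q, Suc (2 * v - q)}"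
      using children_heap by auto
    then have "card {c. 0 < c \<and> c < n \<and> par c = v} \<le> card {2 * v - q, Suc (2 * v - q)}"
      by (intro card_mono) auto
    then show ?thesis
      using two order_trans by blast
  qed
qed

lemma height_crossed_tree:
  assumes "s \<in> teeth" "t \<in> heap_leaves"
  shows "height (crossed_tree n par {(s, t)}) = h"
proof -
  interpret crossing n par s t
    using assms by (rule crossing)
  have depth_less: "depth u < depth v" if "(u, v) \<in> parcs G" for u v
  proof -
    \<comment> \<open>A tooth has depth at most \<open>B + 1\<close>, a heap vertex at least
      \<open>B + 2\<close>: the cross edge lengthens no path beyond what \<open>depth\<close>
      allows.\<close>
    have "depth s < depth t"
      using teethD[OF assms(1)] heap_leavesD[OF assms(2)] q_ge by (auto simp: depth_def)
    with that depth_par_less show ?thesis by auto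
  qed
  have le: "length p \<le> h" if "G.apath u p v" for u p v
  proof -
    have "depth u + length p \<le> depth v"
      using awalk_potential[of G depth, OF depth_less] that by (simp add: G.awalkI_apath)
    moreover have "v < n"
      using G.awalk_last_in_verts[OF G.awalkI_apath[OF that]] by simp
    ultimately show ?thesis using depth_le[of v] by linarith
  qed
  have "\<exists>p. G.awalk 0 p j \<and> length p = j" if "j \<le> h" for j
    using that
  proof (induction j)
    case 0
    show ?case using n by (auto simp: G.awalk_Nil_iff)
  next
    case (Suc j)
    then obtain p where p: "G.awalk 0 p j" "length p = j" by auto
    have "(j, Suc j) \<in> parcs G"
      using Suc.prems q_ge n by (auto simp: par_def)
    then have "G.awalk j [(j, Suc j)] (Suc j)"
      using G.arc_implies_awalk[of "(j, Suc j)"] by (simp del: crossed_tree_simps)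
    then have "G.awalk 0 (p @ [(j, Suc j)]) (Suc j)"
      using p(1) G.awalk_appendI by blast
    then show ?case using p(2) by (metis length_append_singleton)
  qed
  then obtain p where p: "G.awalk 0 p h" "length p = h" by blast
  then have "G.apath 0 p h"
    using distinct_awalk_increasing[of G p 0 h] arcs_G by (auto simp: G.apath_def G.awalk_def simp del: crossed_tree_simps)
  then have "h \<in> {length p | u p v. G.apath u p v}"
    using p(2) by blast
  moreover have "finite {length p | u p v. G.apath u p v}"
    by (rule finite_subset[of _ "{..h}"]) (use le in auto)
  ultimately show ?thesis
    unfolding height_def using le by (intro Max_eqI) auto
qed

lemma max_degree_crossed_tree:
  assumes "s \<in> teeth" "t \<in> heap_leaves"
  shows "max_degree (crossed_tree n par {(s, t)}) = d"
proof -
  interpret crossing n par s t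
    using assms by (rule crossing)
  note s = teethD[OF assms(1)] and t = heap_leavesD[OF assms(2)]
  let ?deg = "\<lambda>v. in_degree (with_proj G) v + out_degree (with_proj G) v"
  have "card (insert 1 {h + B<..q}) = d"
    using q d B by simp
  then have deg_0: "?deg 0 = d"
    using in_degree_G[of 0] s_pos by (simp add: out_degree_G children_root)
  have "?deg v \<le> d" if "v < n" for v
  proof -
    consider "v = 0" | "v = s" | "v = t" | "0 < v" "v \<noteq> s" "v \<noteq> t"
      using s_pos by auto
    then show ?thesis
    proof cases
      case 2
      then have "{c. 0 < c \<and> c < n \<and> par c = v} = {}"
        using s_leaf by auto
      then have "out_degree (with_proj G) v = 1"
        using 2 by (simp only: out_degree_G) simp
      moreover have "in_degree (with_proj G) v \<le> 1"
        using in_degree_G[of v] 2 s_pos st by simp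
      ultimately show ?thesis using d by linarith
    next
      case 3
      then have "{c. 0 < c \<and> c < n \<and> par c = v} = {}"
        using t_leaf by auto
      then have "out_degree (with_proj G) v = 0"
        using 3 st by (simp only: out_degree_G) simp
      moreover have "in_degree (with_proj G) v \<le> 2"
        using in_degree_G[of v] 3 st by simp
      ultimately show ?thesis using d by linarith
    next
      \<comment> \<open>One parent and two children: degree 3 does occur, whence
        \<open>d \<ge> 3\<close>.\<close>
      case 4
      then have "out_degree (with_proj G) v \<le> 2"
        using card_children_le[of v] by (simp only: out_degree_G) simp
      moreover have "in_degree (with_proj G) v \<le> 1"
        using in_degree_G[of v] 4 by simp
      ultimately show ?thesis using d by linarith
    qed (simp add: deg_0)
  qed
  then show ?thesis
    unfolding max_degree_def using deg_0 n
    by (intro Max_eqI) (auto intro!: image_eqI[where x = 0])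
qed

lemma crossed_tree_in_almost_trees:
  assumes "s \<in> teeth" "t \<in> heap_leaves"
  shows "crossed_tree n par {(s, t)} \<in> almost_trees n d h"
  unfolding almost_trees_def mem_Collect_eq
  by (intro conjI crossing.almost_tree_G[OF crossing] height_crossed_tree max_degree_crossed_tree assms crossed_tree_simps(1))

text \<open>All graphs of the family answer like \<open>base\<close> except at their own cross edge,
  which is the hidden pair setting with \<open>B * card heap_leaves\<close> pairs.\<close>

lemma hard_on_average_crossed_trees:
  assumes "0 < B"
  shows "hard_on_average (almost_trees n d h) ((real (B * card heap_leaves) - 1) / 2)"
proof -
  let ?E = "teeth \<times> heap_leaves"
  let ?G = "\<lambda>e. crossed_tree n par {e}"
  have fin: "finite ?E"
    unfolding teeth_def heap_leaves_def
    by (intro finite_cartesian_product finite_greaterThanAtMost finite_atLeastLessThan)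
  have card: "card ?E = B * card heap_leaves"
    unfolding card_cartesian_product by (simp add: teeth_def)
  have ne: "?E \<noteq> {}"
  proof -
    have "Suc h \<in> teeth" "n - 1 \<in> heap_leaves"
      using assms n unfolding teeth_def heap_leaves_def by auto
    then show ?thesis by blast
  qed
  have sub: "?G ` ?E \<subseteq> almost_trees n d h"
    using crossed_tree_in_almost_trees by auto
  have inj: "inj_on (\<lambda>e. parcs (?G e)) ?E"
  proof (rule inj_onI)
    fix e e' assume e: "e \<in> ?E" "e' \<in> ?E" "parcs (?G e) = parcs (?G e')"
    \<comment> \<open>A base arc equal to \<open>f\<close> would make a tooth a parent. So the cross
      edge can be read off as the only arc outside \<open>base\<close>.\<close>
    have new: "f \<notin> parcs base" if f: "f \<in> ?E" for f
    proof -
      have no_child: "par c \<noteq> fst f" if "0 < c" for c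
        using f teethD[of "fst f"] children_tooth that by auto
      show ?thesis
      proof
        assume "f \<in> parcs base"
        then obtain c where "f = (par c, c)" "0 < c"
          by auto
        with no_child[of c] show False by simp
      qed
    qed
    have "insert e (parcs base) = insert e' (parcs base)"
      using e(3) by simp
    then show "e = e'"
      using new[OF e(1)] new[OF e(2)] by blast
  qed
  have ask: "path_query (?G e) = (\<lambda>x y. path_query base x y \<or> (x, y) = e)" if "e \<in> ?E" for e
    using that crossing.path_query_G[OF crossing] by (auto simp: fun_eq_iff)
  have inj_G: "inj_on ?G ?E"
    using inj by (rule inj_on_imageI2[unfolded o_def])
  have "(real (B * card heap_leaves) - 1) / 2 * card (?G ` ?E) \<le> (\<Sum>G\<in>?G ` ?E. real (queries (path_query G) A))"
    if A: "learns A (almost_trees n d h)" for A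
  proof -
    have res: "result (path_query (?G e)) A = parcs (?G e)" if "e \<in> ?E" for e
      using A sub that unfolding learns_def by blast
    have "card ?E * (card ?E - 1) \<le> 2 * (\<Sum>e\<in>?E. queries (\<lambda>x y. path_query base x y \<or> (x, y) = e) A)"
    proof (rule sum_queries_hidden_pair[OF fin])
      fix x y assume xy: "(x, y) \<in> ?E"
      then interpret crossing n par x y
        using crossing by blast
      show "\<not> path_query base x y"
        using st by (simp add: path_query_def reachable_T_from_s)
    next
      have "result (\<lambda>x y. path_query base x y \<or> (x, y) = e) A = parcs (?G e)" if "e \<in> ?E" for e
        using res[OF that] ask[OF that] by simp
      then show "inj_on (\<lambda>e. result (\<lambda>x y. path_query base x y \<or> (x, y) = e) A) ?E"
        using inj by (simp add: inj_on_def del: crossed_tree_simps)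
    qed
    also have "(\<Sum>e\<in>?E. queries (\<lambda>x y. path_query base x y \<or> (x, y) = e) A) = (\<Sum>e\<in>?E. queries (path_query (?G e)) A)"
      using ask by (intro sum.cong) auto
    finally have "real (card ?E * (card ?E - 1)) \<le> real (2 * (\<Sum>e\<in>?E. queries (path_query (?G e)) A))"
      by (rule of_nat_mono)
    also have "\<dots> = 2 * (\<Sum>e\<in>?E. real (queries (path_query (?G e)) A))"
      by (simp only: of_nat_mult of_nat_numeral of_nat_sum)
    finally have "real (card ?E * (card ?E - 1)) \<le> 2 * (\<Sum>e\<in>?E. real (queries (path_query (?G e)) A))" .
    moreover have square: "real m * (real m - 1) \<le> real (m * (m - 1))" for m
      by (cases m) (auto simp: algebra_simps)
    have "card ?E * (real (card ?E) - 1) \<le> real (card ?E * (card ?E - 1))"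
      by (rule square)
    ultimately have "card ?E * (real (card ?E) - 1) / 2 \<le> (\<Sum>e\<in>?E. real (queries (path_query (?G e)) A))"
      by linarith
    then show ?thesis
      unfolding sum.reindex[OF inj_G] card_image[OF inj_G] o_def card by (simp only: times_divide_eq_left mult.commute)
  qed
  then show ?thesis
    unfolding hard_on_average_def using fin ne sub by (intro exI[of _ "?G ` ?E"]) simp
qed

lemma card_heap_leaves: "n \<le> q + 1 + 2 * card heap_leaves"
proof -
  define m where "m = (n + q + 1) div 2"
  have "2 * m \<le> n + q + 1"
    unfolding m_def by (rule times_div_less_eq_dividend)
  then show ?thesis
    by (simp add: heap_leaves_def flip: m_def)
qed

end

section \<open>Choice of the parameters and the case split on the height\<close>

text \<open>About half of the \<open>\<epsilon> n\<close> vertices off the path may become teeth,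
  the rest serves the heap. With at least \<open>\<epsilon> h / 4\<close> teeth,
  \<open>\<epsilon> n / 8\<close> heap leaves and \<open>(m - 1) / 2 \<ge> m / 4\<close>, the
  constant is \<open>4 * 8 * 4 = 128\<close>.\<close>

lemma hard_on_average_n_h:
  fixes \<epsilon> :: real
  assumes d: "3 \<le> d" and \<epsilon>: "0 < \<epsilon>" "\<epsilon> \<le> 1 / 2"
    and large: "4 * real d + 12 \<le> \<epsilon> * real n" "1 \<le> \<epsilon> * log 2 (real n)"
    and h: "4 * log 2 (real n) \<le> real h" "real h \<le> (1 - \<epsilon>) * real n"
  shows "hard_on_average (almost_trees n d h) (\<epsilon>\<^sup>2 / 128 * (real n * real h))"
proof -
  define B where "B = nat \<lfloor>\<epsilon> * real h / 2\<rfloor>"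
  define q where "q = h + B + d - 1"
  have n_pos: "0 < n"
    using large(1) d by (cases n) auto
  have "\<epsilon> * log 2 (real n) \<le> 1 / 2 * log 2 (real n)"
    using \<epsilon> n_pos by (intro mult_right_mono) auto
  then have log_n: "2 \<le> log 2 (real n)"
    using large(2) by linarith
  have "\<epsilon> * (4 * log 2 (real n)) \<le> \<epsilon> * real h"
    using h(1) \<epsilon>(1) by (intro mult_left_mono) auto
  then have \<epsilon>h: "4 \<le> \<epsilon> * real h"
    using large(2) by linarith
  \<comment> \<open>Rounding down loses less than 1, which is at most
    \<open>\<epsilon> h / 4\<close>.\<close>
  have B_le: "real B \<le> \<epsilon> * real h / 2" and B_ge: "\<epsilon> * real h / 4 \<le> real B" and B_pos: "0 < B"
    using \<epsilon>h unfolding B_def by linarith+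
  have "\<epsilon> * real h \<le> 1 / 2 * real h"
    using \<epsilon>(2) by (rule mult_right_mono) simp
  moreover have "real (floor_log n) \<le> log 2 (real n)"
    using n_pos by (simp add: floor_log_altdef)
  ultimately have "real (B + 2 + floor_log n) \<le> real h"
    using B_le log_n h(1) unfolding of_nat_add of_nat_numeral by linarith
  then have B: "B + 2 + floor_log n \<le> h"
    by (simp only: of_nat_le_iff)
  have "h \<le> n"
    using h(2) \<epsilon> mult_right_mono[of "1 - \<epsilon>" 1 "real n"] by simp
  then have "\<epsilon> * real h \<le> \<epsilon> * real n"
    using \<epsilon>(1) by (intro mult_left_mono) auto
  moreover have "real q = real h + real B + real d - 1"
    using d by (simp add: q_def)
  ultimately have q_le: "real q \<le> real n - \<epsilon> * real n / 2 + real d - 1"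
    using h(2) B_le by (simp add: algebra_simps)
  have "real q + 2 < real n"
    using q_le large(1) of_nat_0_le_iff[of d, where ?'a = real] by linarith
  then have "q + 2 < n"
    by linarith
  then interpret comb_heap n d h B q
    using d B by unfold_locales (auto simp: q_def)
  \<comment> \<open>The heap has at least \<open>\<epsilon> n / 2 - d\<close> vertices, and at least
    half of them are leaves; \<open>4 d \<le> \<epsilon> n\<close> absorbs the loss.\<close>
  have leaves: "\<epsilon> * real n / 8 \<le> real (card heap_leaves)"
  proof -
    have "real n \<le> real q + 1 + 2 * real (card heap_leaves)"
      using card_heap_leaves by linarith
    then show ?thesis
      using q_le large(1) by linarith
  qed
  define m where "m = B * card heap_leaves"
  have "(\<epsilon> * real h / 4) * (\<epsilon> * real n / 8) \<le> real m"
    unfolding m_def of_nat_mult using B_ge leaves \<epsilon>(1) by (intro mult_mono) auto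
  then have m_ge: "\<epsilon>\<^sup>2 * (real n * real h) / 32 \<le> real m"
    by (simp add: power2_eq_square mult.assoc mult.left_commute mult.commute)
  have "1 * (3 / 2) \<le> real B * real (card heap_leaves)"
    using B_pos leaves large(1) d by (intro mult_mono) linarith+
  then have "2 \<le> m"
    unfolding m_def of_nat_mult[symmetric] by linarith
  then have "2 \<le> real m"
    by simp
  have "\<epsilon>\<^sup>2 / 128 * (real n * real h) = \<epsilon>\<^sup>2 * (real n * real h) / 32 / 4"
    by simp
  also have "\<dots> \<le> real m / 4"
    using m_ge by (rule divide_right_mono) simp
  also have "\<dots> \<le> (real m - 1) / 2"
    using \<open>2 \<le> real m\<close> by simp
  finally have "\<epsilon>\<^sup>2 / 128 * (real n * real h) \<le> (real m - 1) / 2" .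
  then show ?thesis
    using hard_on_average_crossed_trees[OF B_pos] hard_on_average_mono unfolding m_def by blast
qed

theorem theorem9:
  fixes d :: nat and \<epsilon> :: real
  assumes "d \<ge> 3" and "\<epsilon> > 0"
  shows "\<exists>c::real. c > 0 \<and>
    (\<forall>n h::nat. almost_trees n d h \<noteq> {} \<and> real h \<le> (1 - \<epsilon>) * real n \<longrightarrow>
      (\<forall>A. learns A (almost_trees n d h) \<longrightarrow>
        (\<exists>G\<in>almost_trees n d h.
          real (queries (path_query G) A) \<ge> c * (real n * log 2 (real n) + real n * real h))) \<and>
      (\<forall>P. always_learns P (almost_trees n d h) \<longrightarrow>
        (\<exists>G\<in>almost_trees n d h.
          expected_queries P G \<ge> ennreal (c * (real n * log 2 (real n) + real n * real h)))))"
proof -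
  \<comment> \<open>Shrinking \<epsilon> only weakens the restriction on \<open>h\<close>.\<close>
  define \<delta> where "\<delta> = min \<epsilon> (1 / 2)"
  have \<delta>: "0 < \<delta>" "\<delta> \<le> 1 / 2" "\<delta> \<le> \<epsilon>"
    using assms(2) by (auto simp: \<delta>_def)
  \<comment> \<open>The first two summands are the threshold of the counting bound; the last one
    yields \<open>\<delta> log n \<ge> 4 d + 12\<close>.\<close>
  define X where "X = nat \<lceil>10 + 2 * real d * log 2 (real d) + 4 * (real d + 3) / \<delta>\<rceil>"
  define N where "N = (2::nat) ^ X"
  \<comment> \<open>For large \<open>h\<close>, \<open>n log n + n h \<le> 5/4 n h\<close>, and
    \<open>160 = 128 * 5/4\<close>. For \<open>n < N\<close> the second term pushes the bound below
    1.\<close>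
  define c where "c = min (\<delta>\<^sup>2 / 160) (1 / (2 * (real N)\<^sup>2))"
  have log_d: "0 \<le> real d * log 2 (real d)"
    using assms(1) by simp
  have X: "10 + 2 * real d * log 2 (real d) + 4 * (real d + 3) / \<delta> \<le> real X"
    unfolding X_def by linarith
  have N_pos: "0 < N"
    by (simp add: N_def)
  have c: "0 < c" "c \<le> \<delta>\<^sup>2 / 160" "c * (2 * (real N)\<^sup>2) \<le> 1"
    using \<delta>(1) N_pos by (auto simp: c_def min_def field_simps)
  have "\<delta>\<^sup>2 \<le> 1\<^sup>2"
    using \<delta> by (intro power_mono) auto
  then have c_le: "c \<le> 1 / 20"
    using c(2) by simp
  have hard: "hard_on_average (almost_trees n d h) (c * (real n * log 2 (real n) + real n * real h))"
    if ne: "almost_trees n d h \<noteq> {}" and h: "real h \<le> (1 - \<epsilon>) * real n" for n h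
  proof (cases "n = 0")
    case True
    then show ?thesis
      using hard_on_average_mono[OF hard_on_average_one[OF ne], of 0] by simp
  next
    case False
    have log_le: "log 2 (real n) \<le> real n" and log_pos: "0 \<le> log 2 (real n)"
      using False log2_le_self[of n] by auto
    have h': "real h \<le> (1 - \<delta>) * real n"
      using h \<delta>(3) mult_right_mono[of "1 - \<epsilon>" "1 - \<delta>" "real n"] by simp
    have h_le: "real h \<le> real n"
      using h' \<delta>(1) mult_right_mono[of "1 - \<delta>" 1 "real n"] by simp
    show ?thesis
    proof (cases "n < N")
      case True
      have "real n * log 2 (real n) + real n * real h \<le> real n * real n + real n * real n"
        using log_le h_le by (intro add_mono mult_left_mono) auto
      also have "\<dots> \<le> 2 * (real N)\<^sup>2"
        using True mult_mono[of "real n" "real N" "real n" "real N"] by (simp add: power2_eq_square)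
      finally have "c * (real n * log 2 (real n) + real n * real h) \<le> c * (2 * (real N)\<^sup>2)"
        using c(1) by (intro mult_left_mono) auto
      with c(3) show ?thesis
        by (intro hard_on_average_mono[OF hard_on_average_one[OF ne]]) linarith
    next
      case large: False
      have "real X = log 2 (real N)"
        by (simp add: N_def log_nat_power)
      also have "\<dots> \<le> log 2 (real n)"
        using large N_pos by (intro log_mono) auto
      finally have log_ge: "10 + 2 * real d * log 2 (real d) + 4 * (real d + 3) / \<delta> \<le> log 2 (real n)"
        using X by linarith
      have quot_pos: "0 \<le> 4 * (real d + 3) / \<delta>"
        using \<delta>(1) by simp
      \<comment> \<open>Below the threshold \<open>n log n + n h \<le> 5 n log n\<close>; above it,
        \<open>log n < h / 4\<close> leaves room for the depth of the heap.\<close>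
      show ?thesis
      proof (cases "real h \<le> 4 * log 2 (real n)")
        case True
        have "real n * real h \<le> real n * (4 * log 2 (real n))"
          using True by (rule mult_left_mono) simp
        then have "c * (real n * log 2 (real n) + real n * real h) \<le> 1 / 20 * (5 * (real n * log 2 (real n)))"
          using c(1) c_le log_pos by (intro mult_mono) auto
        moreover have "hard_on_average (almost_trees n d h) (real n * log 2 (real n) / 4)"
          using assms(1) False ne log_ge quot_pos by (intro hard_on_average_n_log_n) auto
        ultimately show ?thesis
          by (elim hard_on_average_mono) simp
      next
        case False
        have "4 * (real d + 3) / \<delta> \<le> log 2 (real n)"
          using log_ge log_d by linarith
        then have \<delta>_log: "4 * real d + 12 \<le> \<delta> * log 2 (real n)"
          using \<delta>(1) by (simp add: divide_le_eq mult.commute)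
        have "\<delta> * log 2 (real n) \<le> \<delta> * real n"
          using log_le \<delta>(1) by (intro mult_left_mono) auto
        then have "4 * real d + 12 \<le> \<delta> * real n" "1 \<le> \<delta> * log 2 (real n)"
          using \<delta>_log of_nat_0_le_iff[of d, where ?'a = real] by linarith+
        then have "hard_on_average (almost_trees n d h) (\<delta>\<^sup>2 / 128 * (real n * real h))"
          using assms(1) \<delta>(1,2) False h' by (intro hard_on_average_n_h) linarith+
        moreover have "real n * log 2 (real n) \<le> real n * (real h / 4)"
          using False by (intro mult_left_mono) auto
        then have "real n * log 2 (real n) + real n * real h \<le> 5 / 4 * (real n * real h)"
          by (simp add: algebra_simps)
        then have "c * (real n * log 2 (real n) + real n * real h) \<le> \<delta>\<^sup>2 / 160 * (5 / 4 * (real n * real h))"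
          using c log_pos by (intro mult_mono) auto
        then have "c * (real n * log 2 (real n) + real n * real h) \<le> \<delta>\<^sup>2 / 128 * (real n * real h)"
          by (simp add: mult.assoc mult.commute)
        ultimately show ?thesis
          by (rule hard_on_average_mono)
      qed
    qed
  qed
  show ?thesis
  proof (intro exI[of _ c] conjI[OF c(1)] allI impI)
    fix n h :: nat
    assume "almost_trees n d h \<noteq> {} \<and> real h \<le> (1 - \<epsilon>) * real n"
    then show "(\<forall>A. learns A (almost_trees n d h) \<longrightarrow>
        (\<exists>G\<in>almost_trees n d h.
          real (queries (path_query G) A) \<ge> c * (real n * log 2 (real n) + real n * real h))) \<and>
      (\<forall>P. always_learns P (almost_trees n d h) \<longrightarrow>
        (\<exists>G\<in>almost_trees n d h.
          expected_queries P G \<ge> ennreal (c * (real n * log 2 (real n) + real n * real h))))"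
      by (intro worst_case_ge_average hard) auto
  qed
qed

end
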